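(* Let $\ell\in\mathbb{N}$ and let $\Lambda=\{a_1,\dots,a_\ell\}$ be a collection of sequences of positive integers such that (i) for each $i=1,\dots,\ell$ and every $L>0$, $$\lim_{N\to\infty}\frac{1}{N^2}\#\{(m,n)\in[1,N]^2:\ |a_i(m)-a_i(n)|\le L\}=0;$$ (ii) $\lim_{n\to\infty}(a_{i+1}(n)-a_i(n))=+\infty$ for $i=1,\dots,\ell-1$. Then for any measure preserving system $(X,\mathscr{B},\mu,T)$ with Pinsker $\sigma$-algebra $P_\mu(T)$, and any $f_1,\dots,f_\ell\in L^\infty(\mu)$, $$\lim_{N\to\infty}\frac1N\sum_{n=1}^N\left(\prod_{i=1}^\ell T^{a_i(n)}f_i-\prod_{i=1}^\ell T^{a_i(n)}E(f_i|P_\mu(T))\right)=0$$ in $L^2(\mu)$ (that is, the Pinsker $\sigma$-algebra is a characteristic factor for the averages along $\Lambda$).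
   Context: $\mathbb{N}$ is the set of positive integers; a sequence of positive integers is a map $a\colon\mathbb{N}\to\mathbb{N}$; in (i) the pairs $(m,n)$ are pairs of integers, and $\#$ denotes cardinality. A measure preserving system $(X,\mathscr{B},\mu,T)$ consists of a standard Borel space $(X,\mathscr{B})$, a probability measure $\mu$ on it, and an invertible measure preserving transformation $T$ of $(X,\mathscr{B},\mu)$. For a function $f$ on $X$, $T^nf=f\circ T^n$. $E(\cdot|\mathscr{A})$ denotes conditional expectation with respect to a sub-$\sigma$-algebra $\mathscr{A}\subseteq\mathscr{B}$. The Pinsker $\sigma$-algebra is $P_\mu(T)=\{A\in\mathscr{B}: h_\mu(T,\{A,X\setminus A\})=0\}$, where for a finite measurable partition $\alpha$, $h_\mu(T,\alpha)=\lim_{n\to\infty}\frac1nH_\mu(\bigvee_{i=0}^{n-1}T^{-i}\alpha)$ and $H_\mu(\alpha)=-\sum_{A\in\alpha}\mu(A)\log\mu(A)$. *)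

theory Defs
  imports "HOL-Probability.Probability"
begin

definition standard_borel :: "'a measure \<Rightarrow> bool" where
  "standard_borel M \<longleftrightarrow>
     (\<exists>S. completely_metrizable_space S \<and> second_countable S \<and> topspace S = space M \<and>
          sets M = sigma_sets (space M) {U. openin S U})"

locale measure_preserving_system = prob_space M for M :: "'a measure" +
  fixes T :: "'a \<Rightarrow> 'a"
  assumes standard_borel: "standard_borel M"
    and T_measurable: "T \<in> M \<rightarrow>\<^sub>M M"
    and T_bij: "bij_betw T (space M) (space M)"
    and T_inv_measurable: "inv_into (space M) T \<in> M \<rightarrow>\<^sub>M M"
    and T_preserves: "\<And>A. A \<in> sets M \<Longrightarrow> emeasure M (T -` A \<inter> space M) = emeasure M A"

definition partition_entropy :: "'a measure \<Rightarrow> 'a set set \<Rightarrow> real" where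
  "partition_entropy M \<alpha> = - (\<Sum>A\<in>\<alpha>. measure M A * ln (measure M A))"

definition preimage_partition ::
  "'a measure \<Rightarrow> ('a \<Rightarrow> 'a) \<Rightarrow> nat \<Rightarrow> 'a set set \<Rightarrow> 'a set set" where
  "preimage_partition M T i \<alpha> = (\<lambda>A. (T ^^ i) -` A \<inter> space M) ` \<alpha>"

text \<open>The library's \<open>common_refinement\<close> is the join of a set of partitions. It discards empty
  cells, which contribute nothing to the entropy.\<close>

definition ks_entropy :: "'a measure \<Rightarrow> ('a \<Rightarrow> 'a) \<Rightarrow> 'a set set \<Rightarrow> real" where
  "ks_entropy M T \<alpha> =
     lim (\<lambda>n. partition_entropy M
                (common_refinement ((\<lambda>i. preimage_partition M T i \<alpha>) ` {..<n})) / real n)"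

text \<open>In a measure preserving system the zero-entropy sets already form a \<open>\<sigma>\<close>-algebra (a standard
  fact), so \<open>sigma\<close> adds no sets; it packages the family as a value of type \<open>'a measure\<close>, the
  form in which \<open>real_cond_exp\<close> expects a sub-\<open>\<sigma>\<close>-algebra. The measure it carries is not used:
  \<open>real_cond_exp\<close> takes the measure from its first argument.\<close>

definition pinsker_algebra :: "'a measure \<Rightarrow> ('a \<Rightarrow> 'a) \<Rightarrow> 'a measure" where
  "pinsker_algebra M T = sigma (space M) {A \<in> sets M. ks_entropy M T {A, space M - A} = 0}"

text \<open>The library has conditional expectation only for real-valued functions.\<close>

definition complex_cond_exp ::
  "'a measure \<Rightarrow> 'a measure \<Rightarrow> ('a \<Rightarrow> complex) \<Rightarrow> 'a \<Rightarrow> complex" where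
  "complex_cond_exp M F f =
     (\<lambda>x. Complex (real_cond_exp M F (\<lambda>y. Re (f y)) x) (real_cond_exp M F (\<lambda>y. Im (f y)) x))"

definition Linf :: "'a measure \<Rightarrow> ('a \<Rightarrow> complex) set" where
  "Linf M = {f \<in> borel_measurable M. \<exists>C::real. AE x in M. cmod (f x) \<le> C}"

definition L2 :: "'a measure \<Rightarrow> ('a \<Rightarrow> complex) set" where
  "L2 M = {f \<in> borel_measurable M. integrable M (\<lambda>x. (cmod (f x))\<^sup>2)}"

definition L2_norm :: "'a measure \<Rightarrow> ('a \<Rightarrow> complex) \<Rightarrow> real" where
  "L2_norm M f = sqrt (LINT x|M. (cmod (f x))\<^sup>2)"

text \<open>Membership in \<open>L2\<close> is part of the notion, because the Bochner integral in \<open>L2_norm\<close> is \<open>0\<close>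
  by convention on non-integrable functions.\<close>

definition tendsto_L2 ::
  "'a measure \<Rightarrow> (nat \<Rightarrow> 'a \<Rightarrow> complex) \<Rightarrow> ('a \<Rightarrow> complex) \<Rightarrow> bool" where
  "tendsto_L2 M F g \<longleftrightarrow>
     (\<forall>N. F N \<in> L2 M) \<and> g \<in> L2 M \<and> (\<lambda>N. L2_norm M (\<lambda>x. F N x - g x)) \<longlonglongrightarrow> 0"

end

theory Submission
  imports Defs
begin

text \<open>
  Telescoping writes the difference of the two products as a sum over \<open>j\<close> of products in which the
  factors before the \<open>j\<close>-th are Pinsker measurable, the \<open>j\<close>-th factor \<open>g\<close> has conditional expectation
  \<open>0\<close> given the Pinsker algebra, and the later ones are arbitrary bounded functions. Expanding the
  square of the norm of the average turns it into the mean over pairs \<open>(m, n)\<close> of the correlations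
  of the products at times \<open>a i m\<close> and \<open>a i n\<close>. As close values of one sequence are rare, all but a
  vanishing proportion of the pairs satisfy \<open>\<bar>a j m - a j n\<bar> > L\<close>; say \<open>s = a j m\<close> is the smaller
  time. As the gaps between successive sequences tend to infinity, all factors with index above \<open>j\<close>,
  at \<open>m\<close> as well as at \<open>n\<close>, then come later than \<open>s + L\<close>. So up to Pinsker factors \<open>g\<close> is alone at
  the earliest time \<open>s\<close>. That times \<open>a i m\<close> and \<open>a k n\<close> with different indices may be close to each
  other is harmless, since only the earliest time has to be isolated.

  Approximating all other factors by simple functions, one finds a finite family \<open>\<Xi>\<close> of sets such
  that their product is measurable with respect to the future of \<open>\<Xi>\<close> after time \<open>s + L\<close>, that is, the
  \<open>\<sigma>\<close>-algebra generated by the preimages of members of \<open>\<Xi>\<close> under iterates of order at least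
  \<open>s + L\<close>, and by the null sets. For the later factors this is a matter of their times. For the Pinsker
  factors, whose times may be early, it holds because a set of zero entropy is determined by its own
  arbitrarily remote future (lemma \<open>zero_entropy_in_future\<close>). Conversely, a set that belongs to the
  future of \<open>\<Xi>\<close> after every time has zero entropy (lemma \<open>remote_future_zero_entropy\<close>). By a reverse
  martingale argument the conditional expectations of \<open>g\<close> given the future of \<open>\<Xi>\<close> after time \<open>L\<close>
  therefore tend to \<open>0\<close> in mean as \<open>L\<close> grows (lemma \<open>cond_exp_future_LIMSEQ\<close>), which makes the
  correlation small, uniformly in \<open>s\<close> (lemmas \<open>future_decorrelation\<close> and \<open>correlation_small\<close>).

  The two entropy facts come from the finite inequalities for Shannon entropy. The partition
  generated by a finite family of sets is represented by the family itself. Joins become unions, and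
  entropy is a monotone and submodular function of the family, invariant under \<open>T\<close>; a set has small
  conditional entropy given a family exactly when it is close in measure to a set generated by it.
\<close>

section \<open>Entropy of a finite family of sets\<close>

definition eta :: "real \<Rightarrow> real" where
  "eta t = - (t * ln t)"

lemma eta_0 [simp]: "eta 0 = 0" and eta_1 [simp]: "eta 1 = 0"
  by (auto simp: eta_def)

text \<open>
  The entropy gained when an atom of mass \<open>u + v\<close> is split into parts of mass \<open>u\<close> and \<open>v\<close>.
\<close>

definition split_entropy :: "real \<Rightarrow> real \<Rightarrow> real" where
  "split_entropy u v = eta u + eta v - eta (u + v)"

lemma split_entropy_commute: "split_entropy u v = split_entropy v u"
  by (simp add: split_entropy_def add.commute)

lemma split_entropy_0 [simp]: "split_entropy 0 v = 0" "split_entropy v 0 = 0"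
  by (simp_all add: split_entropy_def)

text \<open>
  The summands are the values at \<open>(u1, c1)\<close> and \<open>(u2, c2)\<close> of \<open>u * ln (c / u)\<close>, which is homogeneous and
  concave, hence superadditive. The proof applies \<open>ln y \<le> y - 1\<close> with \<open>y\<close> the ratio of \<open>c / u\<close> to the ratio
  of the sums.
\<close>

lemma log_sum_inequality:
  fixes u1 u2 c1 c2 :: real
  assumes "0 \<le> u1" "0 \<le> u2" "u1 \<le> c1" "u2 \<le> c2"
  shows "u1 * ln c1 - u1 * ln u1 + (u2 * ln c2 - u2 * ln u2)
           \<le> (u1 + u2) * ln (c1 + c2) - (u1 + u2) * ln (u1 + u2)"
proof -
  consider "u1 = 0" | "u2 = 0" | "u1 > 0" "u2 > 0"
    using assms by linarith
  then show ?thesis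
  proof cases
    case 1
    then show ?thesis
      using assms by (cases "u2 = 0") (auto intro!: mult_left_mono)
  next
    case 2
    then show ?thesis
      using assms by (cases "u1 = 0") (auto intro!: mult_left_mono)
  next
    case 3
    define U C where "U = u1 + u2" and "C = c1 + c2"
    have pos: "U > 0" "C > 0" "c1 > 0" "c2 > 0"
      using 3 assms by (auto simp: U_def C_def)
    have *: "u * (ln c - ln u - ln C + ln U) \<le> c * U / C - u" if "u > 0" "c > 0" for u c
    proof -
      have "ln c - ln u - ln C + ln U = ln (c * U / (u * C))"
        using that pos by (simp add: ln_mult ln_div)
      also have "\<dots> \<le> c * U / (u * C) - 1"
        using that pos by (intro ln_le_minus_one) auto
      finally have "u * (ln c - ln u - ln C + ln U) \<le> u * (c * U / (u * C) - 1)"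
        using that by (intro mult_left_mono) auto
      also have "\<dots> = c * U / C - u"
        using that pos by (simp add: field_simps)
      finally show ?thesis .
    qed
    have "c1 * U / C + c2 * U / C = U"
      using pos by (simp add: add_divide_distrib[symmetric] distrib_right[symmetric] C_def)
    then show ?thesis
      using *[of u1 c1] *[of u2 c2] 3 pos unfolding U_def[symmetric] C_def[symmetric]
      by (simp add: algebra_simps U_def)
  qed
qed

text \<open>
  This is the concavity behind submodularity: splitting an atom by a set gains at least as much
  entropy as splitting two parts of the atom separately.
\<close>

lemma split_entropy_superadditive:
  assumes "0 \<le> u1" "0 \<le> v1" "0 \<le> u2" "0 \<le> v2"
  shows "split_entropy u1 v1 + split_entropy u2 v2 \<le> split_entropy (u1 + u2) (v1 + v2)"
  using log_sum_inequality[of u1 u2 "u1 + v1" "u2 + v2"]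
        log_sum_inequality[of v1 v2 "u1 + v1" "u2 + v2"] assms
  by (simp add: split_entropy_def eta_def algebra_simps)

text \<open>
  The smaller part has at most half of the mass, so each unit of it contributes at least \<open>ln 2\<close>.
  This converts small conditional entropy into closeness in measure.
\<close>

lemma split_entropy_ge_min:
  assumes "0 \<le> u" "0 \<le> v"
  shows "ln 2 * min u v \<le> split_entropy u v"
proof -
  have *: "ln 2 * u \<le> split_entropy u v" if "0 < u" "u \<le> v" for u v :: real
  proof -
    have "ln 2 + ln u \<le> ln (u + v)"
      using that ln_le_cancel_iff[of "2 * u" "u + v"] by (simp add: ln_mult)
    then have "u * (ln 2 + ln u) \<le> u * ln (u + v)"
      using that by (intro mult_left_mono) auto
    moreover have "v * ln v \<le> v * ln (u + v)"
      using that by (intro mult_left_mono) auto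
    ultimately show ?thesis
      by (simp add: split_entropy_def eta_def algebra_simps)
  qed
  show ?thesis
    using *[of u v] *[of v u] assms
    by (cases "u = 0"; cases "v = 0"; cases "u \<le> v") (auto simp: min_def split_entropy_commute)
qed

lemma split_entropy_nonneg: "0 \<le> u \<Longrightarrow> 0 \<le> v \<Longrightarrow> 0 \<le> split_entropy u v"
  using split_entropy_ge_min[of u v] by (smt (verit) ln_gt_zero_iff mult_nonneg_nonneg)

lemma isCont_eta: "isCont eta t" if "t > 0"
  unfolding eta_def by (intro continuous_intros) (use that in auto)

lemma split_entropy_small:
  assumes "\<delta> > 0"
  obtains \<epsilon> where "\<epsilon> > 0" "\<And>t. 0 \<le> t \<Longrightarrow> t < \<epsilon> \<Longrightarrow> split_entropy t (1 - t) < \<delta>"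
proof -
  have "((\<lambda>t. eta t + eta (1 - t)) \<longlongrightarrow> 0 + eta (1 - 0)) (at_right 0)"
  proof (intro tendsto_intros)
    show "(eta \<longlongrightarrow> 0) (at_right 0)"
      unfolding eta_def by real_asymp
    show "((\<lambda>t. eta (1 - t)) \<longlongrightarrow> eta (1 - 0)) (at_right 0)"
      by (intro isCont_tendsto_compose[OF isCont_eta] tendsto_intros) auto
  qed
  then have "\<forall>\<^sub>F t in at_right 0. eta t + eta (1 - t) < \<delta>"
    using assms by (intro order_tendstoD) auto
  then obtain \<epsilon> where "\<epsilon> > 0" "\<And>t. 0 < t \<Longrightarrow> t < \<epsilon> \<Longrightarrow> eta t + eta (1 - t) < \<delta>"
    unfolding eventually_at_right_field by auto
  then show thesis
    using assms by (intro that[of \<epsilon>]) (auto simp: split_entropy_def eta_def le_less)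
qed

lemma sum_Pow_insert:
  fixes h :: "'a set \<Rightarrow> 'b :: comm_monoid_add"
  assumes "finite \<A>" "A \<notin> \<A>"
  shows "(\<Sum>S\<in>Pow (insert A \<A>). h S) = (\<Sum>S\<in>Pow \<A>. h S + h (insert A S))"
proof -
  have "inj_on (insert A) (Pow \<A>)"
    using assms(2) by (auto simp: inj_on_def)
  then have "(\<Sum>S\<in>Pow (insert A \<A>). h S) = (\<Sum>S\<in>Pow \<A>. h S) + (\<Sum>S\<in>Pow \<A>. h (insert A S))"
    using assms unfolding Pow_insert
    by (subst sum.union_disjoint) (auto simp: sum.reindex)
  then show ?thesis by (simp add: sum.distrib)
qed

context prob_space
begin

definition cell :: "'a set set \<Rightarrow> 'a set set \<Rightarrow> 'a set" where
  "cell \<A> S = {x \<in> space M. {A \<in> \<A>. x \<in> A} = S}"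

text \<open>
  Indexing by all subfamilies instead of the nonempty atoms is harmless, since \<open>eta 0 = 0\<close>, and makes
  the effect of adjoining one set a plain sum over the old index set.
\<close>

definition joint_entropy :: "'a set set \<Rightarrow> real" where
  "joint_entropy \<A> = (\<Sum>S\<in>Pow \<A>. eta (prob (cell \<A> S)))"

definition cond_entropy :: "'a set \<Rightarrow> 'a set set \<Rightarrow> real" where
  "cond_entropy A \<A> = joint_entropy (insert A \<A>) - joint_entropy \<A>"

lemma cell_measurable [measurable]:
  assumes "finite \<A>" "\<A> \<subseteq> sets M"
  shows "cell \<A> S \<in> events"
proof -
  have "cell \<A> S = (if S \<subseteq> \<A> then {x \<in> space M. \<forall>A\<in>\<A>. x \<in> A \<longleftrightarrow> A \<in> S} else {})"
    by (auto simp: cell_def)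
  moreover have "{x \<in> space M. \<forall>A\<in>\<A>. x \<in> A \<longleftrightarrow> A \<in> S} \<in> events"
    using assms by (intro sets.sets_Collect_finite_All) (auto intro!: sets.sets_Collect)
  ultimately show ?thesis by simp
qed

lemma cell_insert:
  assumes "A \<notin> \<A>" "S \<subseteq> \<A>"
  shows "cell (insert A \<A>) S = cell \<A> S - A"
    and "cell (insert A \<A>) (insert A S) = cell \<A> S \<inter> A"
  using assms by (auto simp: cell_def)

text \<open>
  Adjoining \<open>A\<close> splits each atom in two. When \<open>A\<close> already belongs to the family, one of the
  two parts of each atom is empty, and both sides vanish.
\<close>

lemma cond_entropy_eq:
  assumes "finite \<A>" "\<A> \<subseteq> events" "A \<in> events"
  shows "cond_entropy A \<A> =
    (\<Sum>S\<in>Pow \<A>. split_entropy (prob (cell \<A> S \<inter> A)) (prob (cell \<A> S - A)))"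
proof (cases "A \<in> \<A>")
  case True
  have "cell \<A> S \<inter> A = {} \<or> cell \<A> S - A = {}" for S
    using True by (auto simp: cell_def)
  then have "split_entropy (prob (cell \<A> S \<inter> A)) (prob (cell \<A> S - A)) = 0" for S
    by (metis measure_empty split_entropy_0)
  moreover have "cond_entropy A \<A> = 0"
    using True by (simp add: cond_entropy_def insert_absorb)
  ultimately show ?thesis by simp
next
  case False
  have "prob (cell \<A> S) = prob (cell \<A> S \<inter> A) + prob (cell \<A> S - A)" for S
    using assms by (subst finite_measure_Union[symmetric]) (auto simp: Int_Diff_Un)
  then show ?thesis
    using False assms(1)
    by (auto simp: cond_entropy_def joint_entropy_def sum_Pow_insert sum_subtractf[symmetric]
          cell_insert split_entropy_def intro!: sum.cong)
qed

lemma cond_entropy_nonneg: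
  assumes "finite \<A>" "\<A> \<subseteq> events" "A \<in> events"
  shows "0 \<le> cond_entropy A \<A>"
  unfolding cond_entropy_eq[OF assms] by (intro sum_nonneg split_entropy_nonneg) auto

lemma cond_entropy_insert_le:
  assumes "finite \<A>" "\<A> \<subseteq> events" "A \<in> events" "B \<in> events"
  shows "cond_entropy A (insert B \<A>) \<le> cond_entropy A \<A>"
proof (cases "B \<in> \<A>")
  case False
  have split: "prob X = prob (X - B) + prob (X \<inter> B)" if "X \<in> events" for X
    using that assms by (subst finite_measure_Union[symmetric]) (auto intro!: arg_cong[of _ _ prob])
  have "cond_entropy A (insert B \<A>) =
      (\<Sum>S\<in>Pow \<A>. split_entropy (prob ((cell \<A> S - B) \<inter> A)) (prob (cell \<A> S - B - A)) +
          split_entropy (prob (cell \<A> S \<inter> B \<inter> A)) (prob (cell \<A> S \<inter> B - A)))"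
    using assms False
    by (subst cond_entropy_eq) (auto simp: sum_Pow_insert cell_insert intro!: sum.cong)
  also have "\<dots> \<le> (\<Sum>S\<in>Pow \<A>. split_entropy (prob (cell \<A> S \<inter> A)) (prob (cell \<A> S - A)))"
  proof (rule sum_mono)
    fix S
    have C: "cell \<A> S \<in> events" using assms by auto
    have "cell \<A> S \<inter> A - B = (cell \<A> S - B) \<inter> A" "cell \<A> S \<inter> A \<inter> B = cell \<A> S \<inter> B \<inter> A"
        "cell \<A> S - A - B = cell \<A> S - B - A" "(cell \<A> S - A) \<inter> B = cell \<A> S \<inter> B - A"
      by auto
    then have "prob (cell \<A> S \<inter> A) = prob ((cell \<A> S - B) \<inter> A) + prob (cell \<A> S \<inter> B \<inter> A)"
         "prob (cell \<A> S - A) = prob (cell \<A> S - B - A) + prob (cell \<A> S \<inter> B - A)"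
      using assms C split[of "cell \<A> S \<inter> A"] split[of "cell \<A> S - A"] by auto
    then show "split_entropy (prob ((cell \<A> S - B) \<inter> A)) (prob (cell \<A> S - B - A)) +
          split_entropy (prob (cell \<A> S \<inter> B \<inter> A)) (prob (cell \<A> S \<inter> B - A))
        \<le> split_entropy (prob (cell \<A> S \<inter> A)) (prob (cell \<A> S - A))"
      by (simp only:) (intro split_entropy_superadditive measure_nonneg)
  qed
  also have "\<dots> = cond_entropy A \<A>"
    using assms by (simp add: cond_entropy_eq)
  finally show ?thesis .
qed (simp add: insert_absorb)

lemma cond_entropy_antimono:
  assumes "finite \<B>" "\<B> \<subseteq> events" "A \<in> events" "\<A> \<subseteq> \<B>"
  shows "cond_entropy A \<B> \<le> cond_entropy A \<A>"
proof -
  have "finite \<A>" using assms finite_subset by auto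
  have "cond_entropy A (\<A> \<union> \<C>) \<le> cond_entropy A \<A>" if "finite \<C>" "\<C> \<subseteq> events" for \<C>
    using that
  proof (induction \<C>)
    case (insert C \<C>)
    then have "cond_entropy A (insert C (\<A> \<union> \<C>)) \<le> cond_entropy A (\<A> \<union> \<C>)"
      using assms \<open>finite \<A>\<close> by (intro cond_entropy_insert_le) auto
    with insert show ?case by auto
  qed simp
  from this[of \<B>] show ?thesis
    using assms by (simp add: Un_absorb1)
qed

text \<open>
  The chain rule, with the conditioning on sets adjoined earlier dropped.
\<close>

lemma joint_entropy_Un_le:
  assumes "finite \<A>" "\<A> \<subseteq> events" "finite \<B>" "\<B> \<subseteq> events"
  shows "joint_entropy (\<B> \<union> \<A>) \<le> joint_entropy \<A> + (\<Sum>B\<in>\<B>. cond_entropy B \<A>)"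
  using assms(3,4)
proof (induction \<B>)
  case (insert B \<B>)
  then have "cond_entropy B (\<B> \<union> \<A>) \<le> cond_entropy B \<A>"
    using assms by (intro cond_entropy_antimono) auto
  with insert show ?case
    by (simp add: cond_entropy_def)
qed simp

lemma joint_entropy_mono:
  assumes "finite \<B>" "\<B> \<subseteq> events" "\<A> \<subseteq> \<B>"
  shows "joint_entropy \<A> \<le> joint_entropy \<B>"
proof -
  have "finite \<A>" using assms finite_subset by auto
  have "joint_entropy \<A> \<le> joint_entropy (\<A> \<union> \<C>)" if "finite \<C>" "\<C> \<subseteq> events" for \<C>
    using that
  proof (induction \<C>)
    case (insert C \<C>)
    then have "0 \<le> cond_entropy C (\<A> \<union> \<C>)"
      using assms \<open>finite \<A>\<close> by (intro cond_entropy_nonneg) auto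
    with insert show ?case by (simp add: cond_entropy_def)
  qed simp
  from this[of \<B>] show ?thesis
    using assms by (simp add: Un_absorb1)
qed

text \<open>
  Conditioning on more reduces the entropy gained by each set of \<open>\<A>\<close> in turn.
\<close>

lemma joint_entropy_submodular:
  assumes "finite \<A>" "\<A> \<subseteq> events" "finite \<B>" "\<B> \<subseteq> events" "\<C> \<subseteq> \<B>"
  shows "joint_entropy (\<A> \<union> \<B>) - joint_entropy \<B> \<le> joint_entropy (\<A> \<union> \<C>) - joint_entropy \<C>"
  using assms(1,2)
proof (induction \<A>)
  case (insert A \<A>)
  then have "cond_entropy A (\<A> \<union> \<B>) \<le> cond_entropy A (\<A> \<union> \<C>)"
    using assms by (intro cond_entropy_antimono) auto
  with insert show ?case
    by (simp add: cond_entropy_def)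
qed simp

lemma joint_entropy_empty [simp]: "joint_entropy {} = 0"
  by (simp add: joint_entropy_def cell_def prob_space)

lemma cell_sigma_sets_cases:
  assumes "B \<in> sigma_sets (space M) \<A>" "\<A> \<subseteq> events"
  shows "cell \<A> S \<subseteq> B \<or> cell \<A> S \<inter> B = {}"
  using assms
proof (induction rule: sigma_sets.induct)
  case (Basic a)
  then show ?case by (auto simp: cell_def)
next
  case (Compl a)
  then show ?case by (auto simp: cell_def)
qed blast+

text \<open>
  On an atom of \<open>\<A>\<close> the set \<open>B\<close> is everything or nothing, so there the symmetric difference with \<open>A\<close>
  is \<open>A\<close> or its complement. Hence \<open>A\<close> and the symmetric difference have the same conditional entropy.
\<close>

lemma cond_entropy_le_symm_diff:
  assumes "finite \<A>" "\<A> \<subseteq> events" "A \<in> events" "B \<in> sigma_sets (space M) \<A>"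
  defines "t \<equiv> prob ((A - B) \<union> (B - A))"
  shows "cond_entropy A \<A> \<le> split_entropy t (1 - t)"
proof -
  let ?D = "(A - B) \<union> (B - A)"
  have B: "B \<in> events"
    using assms(2,4) sets.sigma_sets_subset by blast
  have "split_entropy (prob (cell \<A> S \<inter> A)) (prob (cell \<A> S - A)) =
      split_entropy (prob (cell \<A> S \<inter> ?D)) (prob (cell \<A> S - ?D))" for S
    using cell_sigma_sets_cases[OF assms(4,2), of S]
  proof
    assume "cell \<A> S \<subseteq> B"
    then have "cell \<A> S \<inter> ?D = cell \<A> S - A" "cell \<A> S - ?D = cell \<A> S \<inter> A" by auto
    then show ?thesis by (metis split_entropy_commute)
  next
    assume "cell \<A> S \<inter> B = {}"
    then have "cell \<A> S \<inter> ?D = cell \<A> S \<inter> A" "cell \<A> S - ?D = cell \<A> S - A" by auto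
    then show ?thesis by metis
  qed
  then have "cond_entropy A \<A> = cond_entropy ?D \<A>"
    using assms B by (simp add: cond_entropy_eq)
  also have "\<dots> \<le> cond_entropy ?D {}"
    using assms B by (intro cond_entropy_antimono) auto
  also have "\<dots> = split_entropy t (1 - t)"
    using assms B prob_compl[of ?D] sets.sets_into_space[of ?D M]
    by (subst cond_entropy_eq) (auto simp: cell_def t_def Int_absorb1)
  finally show ?thesis .
qed

text \<open>
  \<open>B\<close> is the union of the atoms at least half of which lie in \<open>A\<close>, so that each atom contributes the
  smaller of its two parts to the symmetric difference.
\<close>

lemma cond_entropy_ge_symm_diff:
  assumes "finite \<A>" "\<A> \<subseteq> events" "A \<in> events"
  obtains B where "B \<in> sigma_sets (space M) \<A>" "ln 2 * prob ((A - B) \<union> (B - A)) \<le> cond_entropy A \<A>"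
proof -
  define G where "G = {S \<in> Pow \<A>. prob (cell \<A> S - A) \<le> prob (cell \<A> S \<inter> A)}"
  define B where "B = (\<Union>S\<in>G. cell \<A> S)"
  interpret A: sigma_algebra "space M" "sigma_sets (space M) \<A>"
    using assms sets.sets_into_space by (intro sigma_algebra_sigma_sets) blast
  have cell: "cell \<A> S \<in> sigma_sets (space M) \<A>" if "S \<in> Pow \<A>" for S
  proof -
    have "cell \<A> S = (space M \<inter> (\<Inter>A\<in>insert (space M) S. A)) - (\<Union>A\<in>\<A> - S. A)"
      using that by (auto simp: cell_def)
    also have "\<dots> \<in> sigma_sets (space M) \<A>"
      using that assms(1) finite_subset[of S \<A>]
      by (intro A.Diff A.Int A.finite_INT A.finite_UN A.top) auto
    finally show ?thesis .
  qed
  have "finite G" using assms by (auto simp: G_def)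
  then have B: "B \<in> sigma_sets (space M) \<A>"
    unfolding B_def using cell by (intro A.finite_UN) (auto simp: G_def)
  then have Bev: "B \<in> events"
    using assms(2) sets.sigma_sets_subset by blast
  let ?D = "(A - B) \<union> (B - A)"
  have D: "?D \<in> events" using Bev assms by auto
  have disj: "disjoint_family_on (\<lambda>S. cell \<A> S \<inter> ?D) (Pow \<A>)"
    by (auto simp: disjoint_family_on_def cell_def)
  have "?D = (\<Union>S\<in>Pow \<A>. cell \<A> S \<inter> ?D)"
    using sets.sets_into_space[OF D] by (auto simp: cell_def)
  then have "prob ?D = (\<Sum>S\<in>Pow \<A>. prob (cell \<A> S \<inter> ?D))"
    using finite_measure_finite_Union[OF _ _ disj] assms D by (auto simp: image_subset_iff)
  also have "\<dots> = (\<Sum>S\<in>Pow \<A>. min (prob (cell \<A> S \<inter> A)) (prob (cell \<A> S - A)))"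
  proof (rule sum.cong[OF refl])
    fix S assume S: "S \<in> Pow \<A>"
    show "prob (cell \<A> S \<inter> ?D) = min (prob (cell \<A> S \<inter> A)) (prob (cell \<A> S - A))"
    proof (cases "S \<in> G")
      case True
      then have "cell \<A> S \<inter> ?D = cell \<A> S - A" by (auto simp: B_def)
      with True show ?thesis by (auto simp: G_def)
    next
      case False
      have "cell \<A> S \<inter> B = {}" using False by (auto simp: B_def cell_def)
      then have "cell \<A> S \<inter> ?D = cell \<A> S \<inter> A" by auto
      with False S show ?thesis by (auto simp: G_def)
    qed
  qed
  finally have "ln 2 * prob ?D = (\<Sum>S\<in>Pow \<A>. ln 2 * min (prob (cell \<A> S \<inter> A)) (prob (cell \<A> S - A)))"
    by (simp add: sum_distrib_left)
  also have "\<dots> \<le> cond_entropy A \<A>"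
    unfolding cond_entropy_eq[OF assms] by (intro sum_mono split_entropy_ge_min) auto
  finally show thesis using that B by blast
qed

text \<open>
  Only finitely many sets of a countable union matter up to a small error, and each of them is
  approximated by finitely many generators.
\<close>

lemma sigma_sets_approx:
  assumes "\<E> \<subseteq> events" "A \<in> sigma_sets (space M) \<E>" "\<epsilon> > 0"
  shows "\<exists>F B. finite F \<and> F \<subseteq> \<E> \<and> B \<in> sigma_sets (space M) F \<and> prob ((A - B) \<union> (B - A)) < \<epsilon>"
  using assms(2,3)
proof (induction arbitrary: \<epsilon> rule: sigma_sets.induct)
  case (Basic A)
  then show ?case
    by (intro exI[of _ "{A}"] exI[of _ A]) (auto intro: sigma_sets.Basic)
next
  case Empty
  then show ?case
    by (intro exI[of _ "{}"]) (auto intro: sigma_sets.Empty)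
next
  case (Compl A)
  obtain F B where FB: "finite F" "F \<subseteq> \<E>" "B \<in> sigma_sets (space M) F"
      "prob ((A - B) \<union> (B - A)) < \<epsilon>"
    using Compl.IH[OF Compl.prems] by blast
  have "A \<in> events" using Compl.hyps assms(1) sets.sigma_sets_subset by blast
  moreover have "B \<in> events" using FB assms(1) sets.sigma_sets_subset by (meson subset_trans subsetD)
  ultimately have "(space M - A - (space M - B)) \<union> (space M - B - (space M - A)) = (A - B) \<union> (B - A)"
    using sets.sets_into_space by blast
  with FB show ?case
    by (intro exI[of _ F] exI[of _ "space M - B"]) (auto intro: sigma_sets.Compl)
next
  case (Union A)
  have A: "A i \<in> events" for i
    using Union.hyps assms(1) sets.sigma_sets_subset by blast
  have "(\<lambda>n. prob (\<Union>i<n. A i)) \<longlonglongrightarrow> prob (\<Union>n. \<Union>i<n. A i)"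
    using A by (intro finite_Lim_measure_incseq) (auto simp: incseq_def intro: less_le_trans)
  moreover have "(\<Union>n. \<Union>i<n. A i) = (\<Union>i. A i)" by auto
  ultimately have "\<forall>\<^sub>F n in sequentially. prob (\<Union>i. A i) - \<epsilon> / 2 < prob (\<Union>i<n. A i)"
    using Union.prems by (intro order_tendstoD) auto
  then obtain n where n: "prob (\<Union>i. A i) - \<epsilon> / 2 < prob (\<Union>i<n. A i)"
    by (auto simp: eventually_sequentially)
  have "\<exists>F B. finite F \<and> F \<subseteq> \<E> \<and> B \<in> sigma_sets (space M) F \<and>
      prob ((A i - B) \<union> (B - A i)) < \<epsilon> / (2 * (real n + 1))" for i
    using Union.prems by (intro Union.IH) auto
  then obtain F B where FB: "\<And>i. finite (F i)" "\<And>i. F i \<subseteq> \<E>" "\<And>i. B i \<in> sigma_sets (space M) (F i)"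
      "\<And>i. prob ((A i - B i) \<union> (B i - A i)) < \<epsilon> / (2 * (real n + 1))"
    by metis
  have B: "B i \<in> events" for i
    using FB(2,3)[of i] assms(1) sets.sigma_sets_subset by (meson subset_trans subsetD)
  let ?F = "\<Union>i<n. F i" and ?B = "\<Union>i<n. B i"
  interpret F: sigma_algebra "space M" "sigma_sets (space M) ?F"
    using assms(1) FB(2) sets.sets_into_space by (intro sigma_algebra_sigma_sets) blast
  have "B i \<in> sigma_sets (space M) ?F" if "i < n" for i
    using FB(3)[of i] that sigma_sets_mono'[of "F i" ?F] by blast
  then have "?B \<in> sigma_sets (space M) ?F" by (intro F.finite_UN) auto
  moreover have "prob (((\<Union>i. A i) - ?B) \<union> (?B - (\<Union>i. A i))) < \<epsilon>"
  proof -
    let ?D = "\<lambda>i. (A i - B i) \<union> (B i - A i)"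
    have "prob (((\<Union>i. A i) - ?B) \<union> (?B - (\<Union>i. A i)))
        \<le> prob (((\<Union>i. A i) - (\<Union>i<n. A i)) \<union> (\<Union>i<n. ?D i))"
      using A B by (intro finite_measure_mono) auto
    also have "\<dots> \<le> prob ((\<Union>i. A i) - (\<Union>i<n. A i)) + prob (\<Union>i<n. ?D i)"
      using A B by (intro measure_Un_le) auto
    also have "prob ((\<Union>i. A i) - (\<Union>i<n. A i)) = prob (\<Union>i. A i) - prob (\<Union>i<n. A i)"
      using A by (intro finite_measure_Diff) auto
    also have "prob (\<Union>i<n. ?D i) \<le> (\<Sum>i<n. prob (?D i))"
      using A B by (intro finite_measure_subadditive_finite) auto
    also have "(\<Sum>i<n. prob (?D i)) \<le> (\<Sum>i<n. \<epsilon> / (2 * (real n + 1)))"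
      using FB(4) by (intro sum_mono less_imp_le)
    also have "\<dots> \<le> \<epsilon> / 2"
      using Union.prems by (simp add: field_simps)
    finally show ?thesis using n by simp
  qed
  ultimately show ?case
    using FB(1,2) by (intro exI[of _ ?F] exI[of _ ?B]) auto
qed

lemma sigma_sets_cond_entropy_small:
  assumes "\<E> \<subseteq> events" "A \<in> sigma_sets (space M) \<E>" "\<delta> > 0"
  obtains F where "finite F" "F \<subseteq> \<E>" "cond_entropy A F < \<delta>"
proof -
  obtain \<epsilon> where \<epsilon>: "\<epsilon> > 0" "\<And>t. 0 \<le> t \<Longrightarrow> t < \<epsilon> \<Longrightarrow> split_entropy t (1 - t) < \<delta>"
    by (rule split_entropy_small[OF assms(3)]) blast
  obtain F B where FB: "finite F" "F \<subseteq> \<E>" "B \<in> sigma_sets (space M) F"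
      "prob ((A - B) \<union> (B - A)) < \<epsilon>"
    using sigma_sets_approx[OF assms(1,2) \<epsilon>(1)] by blast
  have "A \<in> events"
    using assms sets.sigma_sets_subset by blast
  then have "cond_entropy A F \<le> split_entropy (prob ((A - B) \<union> (B - A))) (1 - prob ((A - B) \<union> (B - A)))"
    using assms FB by (intro cond_entropy_le_symm_diff) auto
  with FB \<epsilon>(2)[OF measure_nonneg FB(4)] that show thesis by fastforce
qed

end

section \<open>Entropy rate and the Pinsker algebra\<close>

text \<open>
  Monotonicity of \<open>d\<close> makes all deviations from the limit nonnegative, so that only an upper bound for
  their mean is required.
\<close>

lemma decseq_Cesaro_mean:
  fixes d :: "nat \<Rightarrow> real"
  assumes "decseq d" "d \<longlonglongrightarrow> \<eta>"
  shows "(\<lambda>n. (\<Sum>k<n. d k) / real n) \<longlonglongrightarrow> \<eta>"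
proof (rule LIMSEQ_I)
  fix r :: real assume r: "r > 0"
  have ge: "\<eta> \<le> d k" for k
    using assms by (rule decseq_ge)
  obtain K where K: "\<And>k. k \<ge> K \<Longrightarrow> d k < \<eta> + r / 2"
    using order_tendstoD(2)[OF assms(2), of "\<eta> + r / 2"] r by (auto simp: eventually_sequentially)
  define C where "C = (\<Sum>k<K. d k - \<eta>)"
  have sum_le: "(\<Sum>k<n. d k - \<eta>) \<le> C + real n * (r / 2)" for n
  proof -
    have "(\<Sum>k<n. d k - \<eta>) \<le> (\<Sum>k<K + n. d k - \<eta>)"
      using ge by (intro sum_mono2) auto
    also have "\<dots> = C + (\<Sum>k<n. d (k + K) - \<eta>)"
      using sum.shift_bounds_nat_ivl[of "\<lambda>k. d k - \<eta>" 0 K n]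
        sum.atLeastLessThan_concat[of 0 K "K + n" "\<lambda>k. d k - \<eta>"]
      by (simp add: C_def lessThan_atLeast0 add.commute)
    also have "(\<Sum>k<n. d (k + K) - \<eta>) \<le> (\<Sum>k<n. r / 2)"
      by (intro sum_mono) (use K in \<open>smt (verit) le_add2\<close>)
    finally show ?thesis by simp
  qed
  have "(\<lambda>n. C / real n) \<longlonglongrightarrow> 0"
    by (rule lim_const_over_n)
  then have "\<forall>\<^sub>F n in sequentially. C / real n < r / 2"
    using r by (intro order_tendstoD) auto
  then obtain N where N: "\<And>n. n \<ge> N \<Longrightarrow> C / real n < r / 2"
    by (auto simp: eventually_sequentially)
  show "\<exists>no. \<forall>n\<ge>no. norm ((\<Sum>k<n. d k) / real n - \<eta>) < r"
  proof (intro exI allI impI)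
    fix n assume n: "n \<ge> max 1 N"
    have eq: "(\<Sum>k<n. d k) / real n - \<eta> = (\<Sum>k<n. d k - \<eta>) / real n"
      using n by (simp add: sum_subtractf diff_divide_distrib)
    have "(\<Sum>k<n. d k - \<eta>) / real n \<le> (C + real n * (r / 2)) / real n"
      using sum_le by (intro divide_right_mono) auto
    also have "\<dots> = C / real n + r / 2"
      using n by (simp add: add_divide_distrib)
    also have "C / real n < r / 2"
      by (rule N) (use n in simp)
    finally have "(\<Sum>k<n. d k - \<eta>) / real n < r" by simp
    moreover have "0 \<le> (\<Sum>k<n. d k - \<eta>) / real n"
      using ge by (intro divide_nonneg_nonneg sum_nonneg) auto
    ultimately show "norm ((\<Sum>k<n. d k) / real n - \<eta>) < r"
      by (simp add: eq)
  qed
qed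

text \<open>
  A nonempty intersection of choices \<open>A\<close> or \<open>space M - A\<close> is the atom of the family of those \<open>A\<close> that were
  chosen positively. This identifies the entropy in the definition of the Pinsker algebra with
  \<open>joint_entropy\<close>.
\<close>

lemma (in prob_space) partition_entropy_common_refinement:
  assumes "finite \<A>" "\<A> \<noteq> {}" "\<A> \<subseteq> events"
  shows "partition_entropy M (common_refinement ((\<lambda>A. {A, space M - A}) ` \<A>)) = joint_entropy \<A>"
proof -
  let ?p = "\<lambda>A. {A, space M - A}"
  have sub: "A \<subseteq> space M" if "A \<in> \<A>" for A
    using that assms sets.sets_into_space by blast
  have "common_refinement (?p ` \<A>) = cell \<A> ` Pow \<A> - {{}}" (is "?L = ?R")
  proof (intro Set.equalityI subsetI)
    fix C assume C: "C \<in> ?L"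
    then obtain f where f': "f \<in> (\<Pi> P\<in>?p ` \<A>. P)" "C = \<Inter> (f ` ?p ` \<A>)" "C \<noteq> {}"
      unfolding common_refinement by blast
    then have f: "f (?p A) \<in> ?p A" if "A \<in> \<A>" for A
      using that by (intro Pi_mem[OF f'(1)]) auto
    have C_eq: "C = (\<Inter>A\<in>\<A>. f (?p A))"
      using f'(2) by (simp add: image_image)
    have "x \<in> C \<longleftrightarrow> x \<in> cell \<A> {A \<in> \<A>. f (?p A) = A}" for x
    proof
      assume x: "x \<in> C"
      have x_in: "x \<in> f (?p A)" if "A \<in> \<A>" for A
        using x that unfolding C_eq by (rule INT_D)
      obtain A0 where "A0 \<in> \<A>" using assms(2) by blast
      then have "x \<in> space M"
        using x_in[of A0] f[of A0] sub[of A0] by auto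
      moreover have "x \<in> A \<longleftrightarrow> f (?p A) = A" if "A \<in> \<A>" for A
        using f[OF that] x_in[OF that] by auto
      ultimately show "x \<in> cell \<A> {A \<in> \<A>. f (?p A) = A}"
        by (auto simp: cell_def)
    next
      assume x: "x \<in> cell \<A> {A \<in> \<A>. f (?p A) = A}"
      then have *: "x \<in> space M" "{A \<in> \<A>. x \<in> A} = {A \<in> \<A>. f (?p A) = A}"
        by (auto simp: cell_def)
      have "x \<in> f (?p A)" if "A \<in> \<A>" for A
      proof -
        have "x \<in> A \<longleftrightarrow> f (?p A) = A" using *(2) that by auto
        with f[OF that] *(1) show ?thesis by auto
      qed
      then show "x \<in> C" unfolding C_eq by auto
    qed
    then have "C = cell \<A> {A \<in> \<A>. f (?p A) = A}" by (intro set_eqI)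
    then show "C \<in> ?R" using f'(3) by auto
  next
    fix C assume "C \<in> ?R"
    then obtain S x where S: "S \<subseteq> \<A>" "C = cell \<A> S" "x \<in> cell \<A> S"
      by blast
    \<comment> \<open>A point \<open>x\<close> of the atom selects the cell containing it from each partition.\<close>
    define f where "f = (\<lambda>P. SOME p :: 'a set. p \<in> P \<and> x \<in> p)"
    have x: "x \<in> space M" "{A \<in> \<A>. x \<in> A} = S"
      using S by (auto simp: cell_def)
    have f: "f (?p A) \<in> ?p A" "x \<in> f (?p A)" for A
    proof -
      have "\<exists>p. p \<in> ?p A \<and> x \<in> p" using x(1) by blast
      from someI_ex[OF this] show "f (?p A) \<in> ?p A" "x \<in> f (?p A)"
        unfolding f_def by blast+
    qed
    have fA: "f (?p A) = (if A \<in> S then A else space M - A)" if "A \<in> \<A>" for A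
      using f[of A] x that by auto
    have "(\<Inter>A\<in>\<A>. f (?p A)) = cell \<A> S"
    proof (intro Set.equalityI subsetI)
      fix y assume "y \<in> (\<Inter>A\<in>\<A>. f (?p A))"
      then have y: "y \<in> (if A \<in> S then A else space M - A)" if "A \<in> \<A>" for A
        using fA[OF that] that by blast
      then have "y \<in> space M"
        using assms(2) sub by (metis DiffD1 all_not_in_conv subsetD)
      moreover have "y \<in> A \<longleftrightarrow> A \<in> S" if "A \<in> \<A>" for A
        using y[OF that] by (auto split: if_splits)
      ultimately show "y \<in> cell \<A> S" using S(1) by (auto simp: cell_def)
    next
      fix y assume "y \<in> cell \<A> S"
      then show "y \<in> (\<Inter>A\<in>\<A>. f (?p A))" by (auto simp: fA cell_def)
    qed
    then have "C = \<Inter> (f ` ?p ` \<A>)" using S(2) by auto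
    moreover have "f \<in> (\<Pi> P\<in>?p ` \<A>. P)" using f(1) by auto
    ultimately show "C \<in> ?L"
      using S unfolding common_refinement by blast
  qed
  also have "\<dots> = cell \<A> ` {S \<in> Pow \<A>. cell \<A> S \<noteq> {}}"
    by blast
  finally have eq: "common_refinement (?p ` \<A>) = cell \<A> ` {S \<in> Pow \<A>. cell \<A> S \<noteq> {}}" .
  have "inj_on (cell \<A>) {S \<in> Pow \<A>. cell \<A> S \<noteq> {}}"
    by (auto simp: inj_on_def cell_def)
  then have "partition_entropy M (common_refinement (?p ` \<A>)) =
      (\<Sum>S\<in>{S \<in> Pow \<A>. cell \<A> S \<noteq> {}}. eta (prob (cell \<A> S)))"
    unfolding eq by (simp add: partition_entropy_def sum.reindex eta_def sum_negf)
  also have "\<dots> = joint_entropy \<A>"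
    unfolding joint_entropy_def using assms(1) by (intro sum.mono_neutral_left) auto
  finally show ?thesis .
qed

context measure_preserving_system
begin

definition pullback :: "nat \<Rightarrow> 'a set \<Rightarrow> 'a set" where
  "pullback k A = (T ^^ k) -` A \<inter> space M"

definition block :: "'a set set \<Rightarrow> nat set \<Rightarrow> 'a set set" where
  "block \<Xi> I = (\<Union>i\<in>I. pullback i ` \<Xi>)"

definition block_entropy :: "'a set set \<Rightarrow> nat \<Rightarrow> real" where
  "block_entropy \<Xi> n = joint_entropy (block \<Xi> {..<n})"

definition entropy_rate :: "'a set set \<Rightarrow> real" where
  "entropy_rate \<Xi> = lim (\<lambda>n. block_entropy \<Xi> n / real n)"

lemma T_pow_measurable [measurable]: "T ^^ k \<in> M \<rightarrow>\<^sub>M M"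
  using T_measurable by (rule measurable_compose_n)

lemma T_pow_space: "x \<in> space M \<Longrightarrow> (T ^^ k) x \<in> space M"
  using measurable_space[OF T_pow_measurable] .

lemma T_pow_surj: "(T ^^ k) ` space M = space M"
proof (induction k)
  case (Suc k)
  have "(T ^^ Suc k) ` space M = T ` ((T ^^ k) ` space M)"
    by (simp add: image_image)
  then show ?case using T_bij Suc by (simp add: bij_betw_def)
qed simp

lemma distr_T_pow: "distr M M (T ^^ k) = M"
proof (induction k)
  case 0
  then show ?case by (simp add: distr_id[unfolded id_def] id_def)
next
  case (Suc k)
  have "distr M M T = M"
    by (rule measure_eqI) (auto simp: emeasure_distr T_measurable T_preserves)
  then show ?case
    using distr_distr[OF T_measurable T_pow_measurable, of k] Suc by (simp only: funpow.simps(2))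
qed

lemma pullback_events [measurable]: "A \<in> events \<Longrightarrow> pullback k A \<in> events"
  unfolding pullback_def by (rule measurable_sets[OF T_pow_measurable])

lemma prob_pullback: "A \<in> events \<Longrightarrow> prob (pullback k A) = prob A"
  unfolding pullback_def using measure_distr[OF T_pow_measurable, of A k] by (simp add: distr_T_pow)

lemma pullback_0: "A \<in> events \<Longrightarrow> pullback 0 A = A"
  using sets.sets_into_space by (auto simp: pullback_def)

lemma pullback_pullback: "pullback i (pullback j A) = pullback (j + i) A"
  by (auto simp: pullback_def funpow_add T_pow_space)

lemma image_pullback:
  assumes "C \<subseteq> space M"
  shows "(T ^^ k) ` pullback k C = C"
proof (intro Set.equalityI subsetI)
  fix y assume y: "y \<in> C"
  with assms have "y \<in> (T ^^ k) ` space M"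
    unfolding T_pow_surj by auto
  then show "y \<in> (T ^^ k) ` pullback k C"
    using y by (auto simp: pullback_def)
qed (auto simp: pullback_def)

lemma pullback_inj:
  assumes "A \<subseteq> space M" "B \<subseteq> space M" "pullback k A = pullback k B"
  shows "A = B"
proof -
  have "A = (T ^^ k) ` pullback k A" by (rule image_pullback[OF assms(1), symmetric])
  also have "\<dots> = B" unfolding assms(3) by (rule image_pullback[OF assms(2)])
  finally show ?thesis .
qed

lemma pullback_image_block: "pullback k ` block \<Xi> I = block \<Xi> ((\<lambda>i. i + k) ` I)"
  by (simp add: block_def image_UN image_image pullback_pullback)

lemma block_events: "\<Xi> \<subseteq> events \<Longrightarrow> block \<Xi> I \<subseteq> events"
  by (auto simp: block_def)

lemma finite_block: "finite \<Xi> \<Longrightarrow> finite I \<Longrightarrow> finite (block \<Xi> I)"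
  by (auto simp: block_def)

lemma block_mono: "\<Xi> \<subseteq> \<Xi>' \<Longrightarrow> I \<subseteq> J \<Longrightarrow> block \<Xi> I \<subseteq> block \<Xi>' J"
  by (auto simp: block_def)

lemma block_Un: "block \<Xi> (I \<union> J) = block \<Xi> I \<union> block \<Xi> J"
  by (auto simp: block_def)

text \<open>
  \<open>T ^^ k\<close> is onto, so taking preimages is injective on families, and it maps atoms to
  atoms of the same measure.
\<close>

lemma joint_entropy_shift:
  assumes "\<A> \<subseteq> events" "finite \<A>"
  shows "joint_entropy (pullback k ` \<A>) = joint_entropy \<A>"
proof -
  have inj: "inj_on (pullback k) \<A>"
  proof (rule inj_onI)
    fix A B assume "A \<in> \<A>" "B \<in> \<A>" and eq: "pullback k A = pullback k B"
    then have "A \<in> events" "B \<in> events" using assms(1) by auto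
    then show "A = B"
      using pullback_inj[OF sets.sets_into_space sets.sets_into_space eq] by simp
  qed
  have "cell (pullback k ` \<A>) (pullback k ` S) = pullback k (cell \<A> S)" if "S \<subseteq> \<A>" for S
  proof (intro Set.equalityI subsetI)
    fix x assume "x \<in> cell (pullback k ` \<A>) (pullback k ` S)"
    then have x: "x \<in> space M" "{A \<in> pullback k ` \<A>. x \<in> A} = pullback k ` S"
      by (auto simp: cell_def)
    have "(T ^^ k) x \<in> A \<longleftrightarrow> A \<in> S" if A: "A \<in> \<A>" for A
    proof -
      have "(T ^^ k) x \<in> A \<longleftrightarrow> pullback k A \<in> {A \<in> pullback k ` \<A>. x \<in> A}"
        using x(1) A by (auto simp: pullback_def)
      also have "\<dots> \<longleftrightarrow> pullback k A \<in> pullback k ` S" unfolding x(2) ..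
      also have "\<dots> \<longleftrightarrow> A \<in> S" using inj A \<open>S \<subseteq> \<A>\<close> by (simp add: inj_on_image_mem_iff)
      finally show ?thesis .
    qed
    then show "x \<in> pullback k (cell \<A> S)"
      using x(1) \<open>S \<subseteq> \<A>\<close> T_pow_space by (auto simp: pullback_def cell_def)
  next
    fix x assume "x \<in> pullback k (cell \<A> S)"
    then have "x \<in> space M" "{A \<in> \<A>. (T ^^ k) x \<in> A} = S"
      by (auto simp: pullback_def cell_def)
    then show "x \<in> cell (pullback k ` \<A>) (pullback k ` S)"
      by (auto simp: cell_def pullback_def)
  qed
  moreover have "(\<Sum>S\<in>Pow (pullback k ` \<A>). eta (prob (cell (pullback k ` \<A>) S))) =
      (\<Sum>S\<in>Pow \<A>. eta (prob (cell (pullback k ` \<A>) (pullback k ` S))))"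
    by (intro sum.reindex_bij_betw[symmetric] bij_betw_Pow) (simp add: inj bij_betw_def)
  ultimately show ?thesis
    using assms by (simp add: joint_entropy_def prob_pullback)
qed

lemma cond_entropy_shift:
  assumes "\<A> \<subseteq> events" "finite \<A>" "A \<in> events"
  shows "cond_entropy (pullback k A) (pullback k ` \<A>) = cond_entropy A \<A>"
  using joint_entropy_shift[of "insert A \<A>" k] joint_entropy_shift[of \<A> k] assms
  by (simp add: cond_entropy_def)

lemma block_entropy_shift:
  assumes "\<Xi> \<subseteq> events" "finite \<Xi>"
  shows "joint_entropy (block \<Xi> {k..<n + k}) = block_entropy \<Xi> n"
proof -
  have "block \<Xi> {k..<n + k} = pullback k ` block \<Xi> {..<n}"
    by (simp add: pullback_image_block lessThan_atLeast0)
  then show ?thesis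
    using assms by (simp add: joint_entropy_shift block_events finite_block block_entropy_def)
qed

context
  fixes \<Xi>
  assumes \<Xi>: "\<Xi> \<subseteq> events" "finite \<Xi>"
begin

text \<open>
  By invariance under \<open>T\<close> the increment is the entropy gained by the present over the next \<open>n\<close> steps,
  which decreases as more of the future is known.
\<close>

lemma block_entropy_increment_decseq:
  "decseq (\<lambda>n. block_entropy \<Xi> (Suc n) - block_entropy \<Xi> n)"
proof (rule decseq_SucI)
  fix n
  have "joint_entropy (block \<Xi> {0} \<union> block \<Xi> {1..<Suc n + 1}) - joint_entropy (block \<Xi> {1..<Suc n + 1})
     \<le> joint_entropy (block \<Xi> {0} \<union> block \<Xi> {1..<n + 1}) - joint_entropy (block \<Xi> {1..<n + 1})"
    using \<Xi> by (intro joint_entropy_submodular block_mono finite_block block_events) auto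
  moreover have "{0} \<union> {1..<n + 1} = {..<Suc n}" for n by auto
  ultimately show "block_entropy \<Xi> (Suc (Suc n)) - block_entropy \<Xi> (Suc n)
      \<le> block_entropy \<Xi> (Suc n) - block_entropy \<Xi> n"
    unfolding block_Un[symmetric] block_entropy_shift[OF \<Xi>]
    by (simp only: block_entropy_def)
qed

lemma block_entropy_increment_nonneg: "0 \<le> block_entropy \<Xi> (Suc n) - block_entropy \<Xi> n"
  using joint_entropy_mono[of "block \<Xi> {..<Suc n}" "block \<Xi> {..<n}"] \<Xi>
  by (auto simp: block_entropy_def finite_block block_events block_mono)

lemma
  shows block_entropy_increment_LIMSEQ:
      "(\<lambda>n. block_entropy \<Xi> (Suc n) - block_entropy \<Xi> n) \<longlonglongrightarrow> entropy_rate \<Xi>"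
    and block_entropy_LIMSEQ: "(\<lambda>n. block_entropy \<Xi> n / real n) \<longlonglongrightarrow> entropy_rate \<Xi>"
proof -
  let ?d = "\<lambda>n. block_entropy \<Xi> (Suc n) - block_entropy \<Xi> n"
  obtain \<eta> where \<eta>: "?d \<longlonglongrightarrow> \<eta>"
    by (rule decseq_convergent[OF block_entropy_increment_decseq allI[OF block_entropy_increment_nonneg]])
  have "block_entropy \<Xi> 0 = 0"
    by (simp add: block_entropy_def block_def)
  then have "(\<Sum>k<n. ?d k) = block_entropy \<Xi> n" for n
    by (simp add: sum_lessThan_telescope)
  then have "(\<lambda>n. block_entropy \<Xi> n / real n) \<longlonglongrightarrow> \<eta>"
    using decseq_Cesaro_mean[OF block_entropy_increment_decseq \<eta>] by simp
  moreover from this have "entropy_rate \<Xi> = \<eta>"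
    unfolding entropy_rate_def by (rule limI)
  ultimately show "?d \<longlonglongrightarrow> entropy_rate \<Xi>" "(\<lambda>n. block_entropy \<Xi> n / real n) \<longlonglongrightarrow> entropy_rate \<Xi>"
    using \<eta> by auto
qed

lemma entropy_rate_le_increment:
  "real m * entropy_rate \<Xi> \<le> block_entropy \<Xi> (n + m) - block_entropy \<Xi> n"
proof (induction m)
  case (Suc m)
  moreover have "entropy_rate \<Xi> \<le> block_entropy \<Xi> (Suc (n + m)) - block_entropy \<Xi> (n + m)"
    by (rule decseq_ge[OF block_entropy_increment_decseq block_entropy_increment_LIMSEQ])
  ultimately show ?case by (simp add: algebra_simps)
qed simp

lemma entropy_rate_nonneg: "0 \<le> entropy_rate \<Xi>"
  using LIMSEQ_le_const[OF block_entropy_increment_LIMSEQ, of 0] block_entropy_increment_nonneg by blast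

end

lemma ks_entropy_eq_entropy_rate:
  assumes "A \<in> events"
  shows "ks_entropy M T {A, space M - A} = entropy_rate {A}"
proof -
  have "partition_entropy M
          (common_refinement ((\<lambda>i. preimage_partition M T i {A, space M - A}) ` {..<n})) / real n
      = block_entropy {A} n / real n" for n
  proof (cases "n = 0")
    case False
    have "preimage_partition M T i {A, space M - A} = {pullback i A, space M - pullback i A}" for i
      using T_pow_space by (auto simp: preimage_partition_def pullback_def)
    then have "(\<lambda>i. preimage_partition M T i {A, space M - A}) ` {..<n} =
        (\<lambda>A. {A, space M - A}) ` block {A} {..<n}"
      by (auto simp: block_def)
    then show ?thesis
      using False assms
      by (subst partition_entropy_common_refinement[of "block {A} {..<n}", symmetric, folded block_entropy_def])
         (auto simp: block_def)
  qed simp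
  then show ?thesis
    by (simp only: ks_entropy_def entropy_rate_def)
qed

lemma joint_entropy_Un_le_add:
  assumes "finite \<A>" "\<A> \<subseteq> events" "finite \<B>" "\<B> \<subseteq> events"
  shows "joint_entropy (\<A> \<union> \<B>) \<le> joint_entropy \<A> + joint_entropy \<B>"
  using joint_entropy_submodular[OF assms, of "{}"] by simp

lemma entropy_rate_le_sum:
  assumes "finite F" "F \<subseteq> events"
  shows "entropy_rate F \<le> (\<Sum>A\<in>F. entropy_rate {A})"
proof -
  have "block_entropy F n \<le> (\<Sum>A\<in>F. block_entropy {A} n)" for n
    using assms
  proof (induction F)
    case (insert A F)
    have "block (insert A F) I = block {A} I \<union> block F I" for I
      by (auto simp: block_def)
    then have "block_entropy (insert A F) n \<le> block_entropy {A} n + block_entropy F n"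
      using insert.prems insert.hyps
      by (auto simp: block_entropy_def intro!: joint_entropy_Un_le_add finite_block block_events)
    with insert show ?case by auto
  qed (simp add: block_entropy_def block_def)
  then have le: "block_entropy F n / real n \<le> (\<Sum>A\<in>F. block_entropy {A} n / real n)" for n
    unfolding sum_divide_distrib[symmetric] by (intro divide_right_mono) auto
  have "(\<lambda>n. \<Sum>A\<in>F. block_entropy {A} n / real n) \<longlonglongrightarrow> (\<Sum>A\<in>F. entropy_rate {A})"
    using assms by (intro tendsto_sum block_entropy_LIMSEQ) auto
  with block_entropy_LIMSEQ[of F] show ?thesis
    by (rule LIMSEQ_le) (use assms le in auto)
qed

text \<open>
  Each preimage of \<open>A\<close> costs at most as much as \<open>A\<close> itself given the block over \<open>I\<close>, provided that \<open>J\<close>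
  contains the correspondingly shifted copy of \<open>I\<close>.
\<close>

lemma joint_entropy_blocks_le:
  assumes "\<Xi> \<subseteq> events" "finite \<Xi>" "A \<in> events"
    and J: "\<And>i. i < n \<Longrightarrow> (\<lambda>k. k + i) ` I \<subseteq> J" "finite J"
  shows "joint_entropy (block {A} {..<n} \<union> block \<Xi> J)
           \<le> joint_entropy (block \<Xi> J) + real n * cond_entropy A (block \<Xi> I)"
proof (cases "n = 0")
  case True
  then show ?thesis by (simp add: block_def)
next
  case False
  have "finite ((\<lambda>k. k + 0) ` I)" using J(1)[of 0] J(2) False finite_subset by blast
  then have I: "finite I" by simp
  let ?c = "cond_entropy A (block \<Xi> I)"
  have c: "0 \<le> ?c"
    using assms I by (intro cond_entropy_nonneg finite_block block_events) auto
  have "joint_entropy (block {A} {..<n} \<union> block \<Xi> J)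
      \<le> joint_entropy (block \<Xi> J) + (\<Sum>B\<in>block {A} {..<n}. cond_entropy B (block \<Xi> J))"
    using assms by (intro joint_entropy_Un_le finite_block block_events) auto
  also have "(\<Sum>B\<in>block {A} {..<n}. cond_entropy B (block \<Xi> J)) \<le> (\<Sum>B\<in>block {A} {..<n}. ?c)"
  proof (rule sum_mono)
    fix B assume "B \<in> block {A} {..<n}"
    then obtain i where i: "i < n" "B = pullback i A" by (auto simp: block_def)
    have "cond_entropy B (block \<Xi> J) \<le> cond_entropy B (pullback i ` block \<Xi> I)"
      unfolding pullback_image_block using assms i
      by (intro cond_entropy_antimono finite_block block_events block_mono) auto
    also have "\<dots> = ?c"
      unfolding i using assms I by (intro cond_entropy_shift finite_block block_events) auto
    finally show "cond_entropy B (block \<Xi> J) \<le> ?c" .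
  qed
  also have "\<dots> = real (card (block {A} {..<n})) * ?c" by simp
  also have "\<dots> \<le> real n * ?c"
  proof (intro mult_right_mono c)
    have "block {A} {..<n} = (\<lambda>i. pullback i A) ` {..<n}" by (auto simp: block_def)
    then show "real (card (block {A} {..<n})) \<le> real n"
      using card_image_le[of "{..<n}" "\<lambda>i. pullback i A"] by simp
  qed
  finally show ?thesis by simp
qed

lemma entropy_rate_le_cond_entropy:
  assumes "F \<subseteq> events" "finite F" "A \<in> events"
  shows "entropy_rate {A} \<le> entropy_rate F + cond_entropy A F"
proof -
  have F: "block F {0} = F" using assms(1) by (auto simp: block_def pullback_0 subset_iff image_iff)
  have le: "block_entropy {A} n / real n \<le> block_entropy F n / real n + cond_entropy A F" if "n \<ge> 1" for n
  proof -
    have "block_entropy {A} n \<le> joint_entropy (block {A} {..<n} \<union> block F {..<n})"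
      unfolding block_entropy_def
      using assms by (intro joint_entropy_mono) (auto simp: finite_block block_events)
    also have "\<dots> \<le> block_entropy F n + real n * cond_entropy A F"
      using joint_entropy_blocks_le[OF assms, of n "{0}" "{..<n}"]
      by (simp add: F block_entropy_def)
    finally show ?thesis using that by (simp add: field_simps)
  qed
  show ?thesis
  proof (rule LIMSEQ_le)
    show "(\<lambda>n. block_entropy {A} n / real n) \<longlonglongrightarrow> entropy_rate {A}"
      using assms by (intro block_entropy_LIMSEQ) auto
    show "(\<lambda>n. block_entropy F n / real n + cond_entropy A F) \<longlonglongrightarrow> entropy_rate F + cond_entropy A F"
      using assms by (intro tendsto_intros block_entropy_LIMSEQ) auto
  qed (use le in blast)
qed

text \<open>
  The zero-entropy sets already form a \<open>\<sigma>\<close>-algebra: a set generated by them has small conditional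
  entropy given finitely many of them, and their joint entropy rate is at most the sum of their
  rates, which is \<open>0\<close>.
\<close>

lemma sets_pinsker_algebra:
  "sets (pinsker_algebra M T) = {A \<in> events. entropy_rate {A} = 0}"
proof -
  let ?Z = "{A \<in> events. entropy_rate {A} = 0}"
  have Z: "{A \<in> events. ks_entropy M T {A, space M - A} = 0} = ?Z"
    by (auto simp: ks_entropy_eq_entropy_rate)
  have "?Z \<subseteq> Pow (space M)" using sets.sets_into_space by blast
  then have sets: "sets (pinsker_algebra M T) = sigma_sets (space M) ?Z"
    unfolding pinsker_algebra_def Z by (rule sets_measure_of)
  have "A \<in> ?Z" if A: "A \<in> sigma_sets (space M) ?Z" for A
  proof -
    have ev: "A \<in> events"
      using A sets.sigma_sets_subset[of ?Z M] by blast
    have "entropy_rate {A} \<le> 0 + \<delta>" if \<delta>: "\<delta> > 0" for \<delta>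
    proof -
      obtain F where F: "finite F" "F \<subseteq> ?Z" "cond_entropy A F < \<delta>"
        by (rule sigma_sets_cond_entropy_small[OF _ A \<delta>]) auto
      have "entropy_rate {A} \<le> entropy_rate F + cond_entropy A F"
        using F ev by (intro entropy_rate_le_cond_entropy) auto
      also have "entropy_rate F \<le> (\<Sum>A\<in>F. entropy_rate {A})"
        using F by (intro entropy_rate_le_sum) auto
      also have "\<dots> = 0" using F(2) by (intro sum.neutral) auto
      finally show ?thesis using F(3) by simp
    qed
    then have "entropy_rate {A} \<le> 0" by (rule field_le_epsilon)
    with ev show ?thesis using entropy_rate_nonneg[of "{A}"] by simp
  qed
  then show ?thesis
    unfolding sets by (intro Set.equalityI subsetI) (assumption | rule sigma_sets.Basic)+
qed

lemma space_pinsker_algebra: "space (pinsker_algebra M T) = space M"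
  unfolding pinsker_algebra_def by (rule space_measure_of) (use sets.sets_into_space in blast)

lemma subalgebra_pinsker: "subalgebra M (pinsker_algebra M T)"
  by (auto simp: subalgebra_def space_pinsker_algebra sets_pinsker_algebra)

end

section \<open>The future of a finite family of sets\<close>

context measure_preserving_system
begin

text \<open>
  The null sets are included because a zero-entropy set is determined by its future only up to
  null sets.
\<close>

definition future :: "'a set set \<Rightarrow> nat \<Rightarrow> 'a measure" where
  "future \<Xi> n = sigma (space M) (block \<Xi> {n..} \<union> null_sets M)"

lemma future_generators_subset: "\<Xi> \<subseteq> events \<Longrightarrow> block \<Xi> I \<union> null_sets M \<subseteq> events"
  using block_events by (auto dest: null_setsD2)

lemma future_generators_Pow: "\<Xi> \<subseteq> events \<Longrightarrow> block \<Xi> I \<union> null_sets M \<subseteq> Pow (space M)"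
  using future_generators_subset[of \<Xi> I] sets.space_closed by (rule order_trans)

lemma sets_future:
  "\<Xi> \<subseteq> events \<Longrightarrow> sets (future \<Xi> n) = sigma_sets (space M) (block \<Xi> {n..} \<union> null_sets M)"
  unfolding future_def by (rule sets_measure_of[OF future_generators_Pow])

lemma space_future: "\<Xi> \<subseteq> events \<Longrightarrow> space (future \<Xi> n) = space M"
  unfolding future_def by (rule space_measure_of[OF future_generators_Pow])

lemma subalgebra_future: "\<Xi> \<subseteq> events \<Longrightarrow> subalgebra M (future \<Xi> n)"
  using sets.sigma_sets_subset[OF future_generators_subset]
  by (auto simp: subalgebra_def space_future sets_future)

lemma sets_future_events: "\<Xi> \<subseteq> events \<Longrightarrow> A \<in> sets (future \<Xi> n) \<Longrightarrow> A \<in> events"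
  using subalgebra_future[of \<Xi> n] unfolding subalgebra_def by blast

lemma future_generator: "\<Xi> \<subseteq> events \<Longrightarrow> B \<in> block \<Xi> {n..} \<union> null_sets M \<Longrightarrow> B \<in> sets (future \<Xi> n)"
  by (simp only: sets_future sigma_sets.Basic)

lemma sets_future_mono:
  assumes "\<Xi>' \<subseteq> events" "\<Xi> \<subseteq> \<Xi>'" "m \<le> n"
  shows "sets (future \<Xi> n) \<subseteq> sets (future \<Xi>' m)"
proof -
  have "block \<Xi> {n..} \<union> null_sets M \<subseteq> block \<Xi>' {m..} \<union> null_sets M"
    using assms by (intro Un_mono block_mono) auto
  then show ?thesis
    using assms by (simp add: sets_future sigma_sets_mono')
qed

lemma null_sets_pullback:
  assumes "N \<in> null_sets M"
  shows "pullback k N \<in> null_sets M"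
  using assms prob_pullback[of N k] pullback_events[of N k]
  by (auto simp: null_sets_def emeasure_eq_measure)

lemma pullback_future:
  assumes "\<Xi> \<subseteq> events" "A \<in> sets (future \<Xi> n)"
  shows "pullback k A \<in> sets (future \<Xi> (n + k))"
proof -
  have "T ^^ k \<in> future \<Xi> (n + k) \<rightarrow>\<^sub>M future \<Xi> n"
  proof (rule measurable_sigma_sets[OF sets_future future_generators_Pow])
    fix B assume B: "B \<in> block \<Xi> {n..} \<union> null_sets M"
    have "pullback k B \<in> block \<Xi> {n + k..} \<union> null_sets M"
    proof (cases "B \<in> null_sets M")
      case False
      have "pullback k B \<in> pullback k ` block \<Xi> {n..}" using B False by auto
      also have "\<dots> \<subseteq> block \<Xi> {n + k..}"
        unfolding pullback_image_block by (intro block_mono) auto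
      finally show ?thesis by simp
    qed (simp add: null_sets_pullback)
    then show "(T ^^ k) -` B \<inter> space (future \<Xi> (n + k)) \<in> sets (future \<Xi> (n + k))"
      using future_generator[OF assms(1)] by (simp add: space_future assms pullback_def)
  qed (use assms T_pow_space space_future in auto)
  from measurable_sets[OF this assms(2)] show ?thesis
    using assms by (simp add: space_future pullback_def)
qed

lemma sets_future_AE_cong:
  assumes "\<Xi> \<subseteq> events" "A \<in> events" "B \<in> sets (future \<Xi> n)" "AE x in M. x \<in> A \<longleftrightarrow> x \<in> B"
  shows "A \<in> sets (future \<Xi> n)"
proof -
  have B: "B \<in> events" using assms by (intro sets_future_events)
  have "AE x in M. x \<notin> A - B" "AE x in M. x \<notin> B - A"
    using assms(4) by auto
  then have "A - B \<in> null_sets M" "B - A \<in> null_sets M"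
    using B assms(2) by (auto simp: AE_iff_null_sets)
  then have "A - B \<in> sets (future \<Xi> n)" "B - A \<in> sets (future \<Xi> n)"
    by (auto intro!: future_generator assms)
  with assms(3) have "(B \<union> (A - B)) - (B - A) \<in> sets (future \<Xi> n)"
    by (rule sets.Diff[OF sets.Un])
  moreover have "(B \<union> (A - B)) - (B - A) = A" by auto
  ultimately show ?thesis by simp
qed

text \<open>
  Null sets carry no entropy, so they can be discarded from a finite family of generators of the
  future.
\<close>

lemma cond_entropy_Un_null:
  assumes "finite F" "F \<subseteq> events" "finite N" "N \<subseteq> null_sets M" "A \<in> events"
  shows "cond_entropy A F \<le> cond_entropy A (F \<union> N)"
proof -
  have N: "N \<subseteq> events" using assms by auto
  have "cond_entropy Z F \<le> 0" if "Z \<in> N" for Z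
  proof -
    have Z: "Z \<in> null_sets M" using that assms by auto
    have "cond_entropy Z F \<le> cond_entropy Z {}"
      using Z assms by (intro cond_entropy_antimono) auto
    also have "\<dots> = 0"
    proof -
      have "space M \<inter> Z \<in> null_sets M" using Z by (intro null_set_Int1) auto
      then have "prob (space M \<inter> Z) = 0" by (rule measure_eq_0_null_sets)
      then show ?thesis using Z by (subst cond_entropy_eq) (auto simp: cell_def)
    qed
    finally show ?thesis .
  qed
  then have "(\<Sum>Z\<in>N. cond_entropy Z F) \<le> 0" by (intro sum_nonpos) auto
  then have "joint_entropy (F \<union> N) \<le> joint_entropy F"
    using joint_entropy_Un_le[of F N] assms N by (simp add: Un_commute)
  moreover have "joint_entropy (insert A F) \<le> joint_entropy (insert A (F \<union> N))"
    using assms N by (intro joint_entropy_mono) auto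
  ultimately show ?thesis by (simp add: cond_entropy_def)
qed

lemma finite_subset_block_atLeast:
  assumes "finite F" "F \<subseteq> block \<Xi> {n..}"
  shows "\<exists>m. F \<subseteq> block \<Xi> {n..<m}"
  using assms
proof (induction F)
  case (insert B F)
  then obtain m where m: "F \<subseteq> block \<Xi> {n..<m}" by auto
  obtain i where i: "i \<ge> n" "B \<in> pullback i ` \<Xi>" using insert.prems by (auto simp: block_def)
  have "block \<Xi> {n..<m} \<subseteq> block \<Xi> {n..<max m (Suc i)}" by (intro block_mono) auto
  moreover have "B \<in> block \<Xi> {n..<max m (Suc i)}"
    using i by (auto simp: block_def intro!: bexI[of _ i])
  ultimately show ?case using m by (intro exI[of _ "max m (Suc i)"]) auto
qed simp

lemma future_cond_entropy_small:
  assumes "\<Xi> \<subseteq> events" "finite \<Xi>" "A \<in> sets (future \<Xi> n)" "\<delta> > 0"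
  obtains m where "cond_entropy A (block \<Xi> {n..<m}) < \<delta>"
proof -
  have A: "A \<in> events" using assms by (intro sets_future_events)
  obtain F where F: "finite F" "F \<subseteq> block \<Xi> {n..} \<union> null_sets M" "cond_entropy A F < \<delta>"
    by (rule sigma_sets_cond_entropy_small[OF future_generators_subset[OF assms(1)] _ assms(4)])
       (use assms sets_future in auto)
  define G where "G = F \<inter> block \<Xi> {n..}"
  obtain m where m: "G \<subseteq> block \<Xi> {n..<m}"
    using finite_subset_block_atLeast[of G \<Xi> n] F by (auto simp: G_def)
  have G: "finite G" "G \<subseteq> events"
    using F block_events[OF assms(1)] by (auto simp: G_def)
  have "cond_entropy A (block \<Xi> {n..<m}) \<le> cond_entropy A G"
    using assms A m by (intro cond_entropy_antimono finite_block block_events) auto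
  also have "\<dots> \<le> cond_entropy A (G \<union> (F - G))"
    using F G A by (intro cond_entropy_Un_null) (auto simp: G_def)
  also have "G \<union> (F - G) = F" by (auto simp: G_def)
  finally show thesis using F(3) by (intro that[of m]) simp
qed

text \<open>
  Zero entropy means that the entropy gained by \<open>A\<close> over its next \<open>n\<close> preimages tends to \<open>0\<close>. So \<open>A\<close> is
  approximated in measure by sets of its strict future, with summable errors along a subsequence,
  and by the Borel--Cantelli lemma it agrees almost everywhere with their lower limit.
\<close>

lemma zero_entropy_in_future_1:
  assumes A: "A \<in> events" and h: "entropy_rate {A} = 0"
  shows "A \<in> sets (future {A} 1)"
proof -
  have Aev: "{A} \<subseteq> events" using A by simp
  have eq: "cond_entropy A (block {A} {1..<n + 1}) = block_entropy {A} (Suc n) - block_entropy {A} n" for n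
  proof -
    have "{..<Suc n} = {0} \<union> {1..<n + 1}" by auto
    then have "block {A} {..<Suc n} = insert A (block {A} {1..<n + 1})"
      using A by (simp only: block_Un) (simp add: block_def pullback_0)
    then show ?thesis
      using block_entropy_shift[OF Aev, of 1 n] by (simp add: cond_entropy_def block_entropy_def)
  qed
  have "\<exists>B. B \<in> sets (future {A} 1) \<and> prob ((A - B) \<union> (B - A)) \<le> (1/2) ^ k" for k
  proof -
    have "(\<lambda>n. block_entropy {A} (Suc n) - block_entropy {A} n) \<longlonglongrightarrow> 0"
      using block_entropy_increment_LIMSEQ[OF Aev] h by simp
    then have "\<forall>\<^sub>F n in sequentially. block_entropy {A} (Suc n) - block_entropy {A} n < ln 2 * (1/2) ^ k"
      by (rule order_tendstoD) simp
    then obtain n where n: "cond_entropy A (block {A} {1..<n + 1}) < ln 2 * (1/2) ^ k"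
      unfolding eq by (auto simp: eventually_sequentially)
    obtain B where B: "B \<in> sigma_sets (space M) (block {A} {1..<n + 1})"
        "ln 2 * prob ((A - B) \<union> (B - A)) \<le> cond_entropy A (block {A} {1..<n + 1})"
      using A Aev by (rule_tac cond_entropy_ge_symm_diff[of "block {A} {1..<n + 1}" A])
        (auto simp: finite_block block_events)
    have "block {A} {1..<n + 1} \<subseteq> block {A} {1..} \<union> null_sets M"
      by (intro le_supI1 block_mono) auto
    then have "B \<in> sets (future {A} 1)"
      unfolding sets_future[OF Aev] using B(1) sigma_sets_mono' by blast
    moreover have "ln 2 * prob ((A - B) \<union> (B - A)) \<le> ln 2 * (1/2) ^ k"
      using B(2) n by linarith
    ultimately show ?thesis by auto
  qed
  then obtain B where B: "\<And>k. B k \<in> sets (future {A} 1)"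
      "\<And>k. prob ((A - B k) \<union> (B k - A)) \<le> (1/2) ^ k"
    by metis
  have Bev: "B k \<in> events" for k
    by (rule sets_future_events[OF Aev B(1)])
  let ?L = "\<Union>m. \<Inter>k\<in>{m..}. B k"
  have "AE x in M. eventually (\<lambda>k. x \<in> space M - ((A - B k) \<union> (B k - A))) sequentially"
  proof (rule borel_cantelli_AE1)
    show "summable (\<lambda>k. prob ((A - B k) \<union> (B k - A)))"
      by (rule summable_comparison_test[of _ "\<lambda>k. (1/2) ^ k"]) (use B(2) in auto)
  qed (use Bev A in \<open>auto simp: emeasure_eq_measure\<close>)
  then have "AE x in M. x \<in> A \<longleftrightarrow> x \<in> ?L"
  proof (rule AE_mp, intro AE_I2 impI)
    fix x assume "eventually (\<lambda>k. x \<in> space M - ((A - B k) \<union> (B k - A))) sequentially"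
    then obtain K where K: "\<And>k. k \<ge> K \<Longrightarrow> x \<in> A \<longleftrightarrow> x \<in> B k"
      by (auto simp: eventually_sequentially)
    show "x \<in> A \<longleftrightarrow> x \<in> ?L"
    proof
      assume "x \<in> A"
      with K show "x \<in> ?L" by auto
    next
      assume "x \<in> ?L"
      then obtain m where "\<And>k. k \<ge> m \<Longrightarrow> x \<in> B k" by auto
      from this[of "max m K"] K[of "max m K"] show "x \<in> A" by simp
    qed
  qed
  moreover have "?L \<in> sets (future {A} 1)"
    using B(1) by (intro sets.countable_UN sets.countable_INT') auto
  ultimately show ?thesis
    using sets_future_AE_cong[OF Aev A] by blast
qed

text \<open>
  Pulling back the previous lemma shows that each generator of the future of \<open>A\<close> after time \<open>k\<close>
  lies in the future after time \<open>k + 1\<close>, so that all these futures coincide.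
\<close>

lemma zero_entropy_in_future:
  assumes A: "A \<in> events" and h: "entropy_rate {A} = 0"
  shows "pullback a A \<in> sets (future {A} n)"
proof -
  have Aev: "{A} \<subseteq> events" using A by simp
  have step: "sets (future {A} k) \<subseteq> sets (future {A} (Suc k))" for k
  proof -
    have "B \<in> sets (future {A} (Suc k))" if "B \<in> block {A} {k..} \<union> null_sets M" for B
    proof (cases "B = pullback k A")
      case True
      then show ?thesis
        using pullback_future[OF Aev zero_entropy_in_future_1[OF assms], of k] by simp
    next
      case False
      have "{k..} = {k} \<union> {Suc k..}" by auto
      with that False have "B \<in> block {A} {Suc k..} \<union> null_sets M"
        by (simp only: block_Un) (auto simp: block_def)
      then show ?thesis by (rule future_generator[OF Aev])
    qed
    then show ?thesis
      unfolding sets_future[OF Aev, of k]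
      by (intro sets.sigma_sets_subset[of _ "future {A} (Suc k)", unfolded space_future[OF Aev]]) blast
  qed
  have "pullback a A \<in> sets (future {A} a)"
    by (intro future_generator Aev) (auto simp: block_def)
  also have "\<dots> \<subseteq> sets (future {A} (max a n))"
    by (rule lift_Suc_mono_le[of "\<lambda>k. sets (future {A} k)", OF step]) simp
  also have "\<dots> \<subseteq> sets (future {A} n)"
    by (intro sets_future_mono Aev) auto
  finally show ?thesis .
qed

text \<open>
  Let \<open>X\<close> and \<open>Z\<close> be the blocks of \<open>\<Xi>\<close> and of \<open>A\<close> over the first \<open>n\<close> times. As \<open>A\<close> lies in the future of \<open>\<Xi>\<close>,
  the joint entropy of \<open>X\<close> and \<open>Z\<close> exceeds the \<open>n\<close>-block entropy of \<open>\<Xi>\<close> by at most \<open>o n + n * \<delta>\<close>. On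
  the other hand \<open>Z\<close> is almost determined by a block \<open>Y\<close> of \<open>\<Xi>\<close> after time \<open>n\<close>, given which \<open>X\<close> still has
  entropy at least \<open>n\<close> times the rate of \<open>\<Xi>\<close>. Subtracting, almost nothing is left for the entropy
  of \<open>Z\<close>.
\<close>

lemma remote_future_zero_entropy:
  assumes \<Xi>: "\<Xi> \<subseteq> events" "finite \<Xi>" and A: "\<And>n. A \<in> sets (future \<Xi> n)"
  shows "entropy_rate {A} = 0"
proof -
  have Aev: "A \<in> events" by (rule sets_future_events[OF \<Xi>(1) A])
  let ?\<eta> = "entropy_rate \<Xi>"
  have "entropy_rate {A} / 2 \<le> 0 + \<delta>" if \<delta>: "\<delta> > 0" for \<delta>
  proof -
    obtain K where K: "cond_entropy A (block \<Xi> {0..<K}) < \<delta>"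
      by (rule future_cond_entropy_small[OF \<Xi> A[of 0] \<delta>])
    have bound: "block_entropy {A} n \<le> block_entropy \<Xi> (n + K) - real n * ?\<eta> + 2 * (real n * \<delta>)" for n
    proof -
      let ?X = "block \<Xi> {..<n}" and ?Z = "block {A} {..<n}"
      obtain m where m: "cond_entropy A (block \<Xi> {n..<m}) < \<delta>"
        by (rule future_cond_entropy_small[OF \<Xi> A[of n] \<delta>])
      let ?Y = "block \<Xi> {n..<m + n}"
      have fin: "finite ?X" "finite ?Y" "finite ?Z" and ev: "?X \<subseteq> events" "?Y \<subseteq> events" "?Z \<subseteq> events"
        using \<Xi> Aev by (auto intro!: finite_block block_events)
      \<comment> \<open>\<open>Y\<close> extends \<open>n\<close> steps beyond \<open>m\<close> so as to almost determine all \<open>n\<close> preimages of \<open>A\<close> in \<open>Z\<close>.\<close>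
      have "joint_entropy (?Z \<union> ?Y) \<le> joint_entropy ?Y + real n * cond_entropy A (block \<Xi> {n..<m})"
        using \<Xi> Aev by (intro joint_entropy_blocks_le) auto
      also have "\<dots> \<le> block_entropy \<Xi> m + real n * \<delta>"
        using m by (intro add_mono mult_left_mono) (auto simp: block_entropy_shift \<Xi>)
      finally have ZY: "joint_entropy (?Z \<union> ?Y) \<le> block_entropy \<Xi> m + real n * \<delta>" .
      have "?X \<union> ?Y = block \<Xi> {..<m + n}"
        unfolding block_Un[symmetric] by (intro arg_cong[of _ _ "block \<Xi>"]) auto
      then have "block_entropy \<Xi> (m + n) \<le> joint_entropy (?X \<union> (?Z \<union> ?Y))"
        using fin ev by (auto simp: block_entropy_def intro!: joint_entropy_mono)
      moreover have "real n * ?\<eta> \<le> block_entropy \<Xi> (m + n) - block_entropy \<Xi> m"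
        by (rule entropy_rate_le_increment[OF \<Xi>])
      moreover have "joint_entropy (?X \<union> (?Z \<union> ?Y)) - joint_entropy (?Z \<union> ?Y)
          \<le> joint_entropy (?X \<union> ?Z) - joint_entropy ?Z"
        using fin ev by (intro joint_entropy_submodular) auto
      ultimately have lower: "real n * ?\<eta> - real n * \<delta> \<le> joint_entropy (?X \<union> ?Z) - joint_entropy ?Z"
        using ZY by linarith
      have "joint_entropy (?X \<union> ?Z) \<le> joint_entropy (?Z \<union> block \<Xi> {..<n + K})"
        using fin ev \<Xi> block_mono[of \<Xi> \<Xi> "{..<n}" "{..<n + K}"]
        by (intro joint_entropy_mono) (auto simp: finite_block block_events)
      also have "\<dots> \<le> joint_entropy (block \<Xi> {..<n + K}) + real n * cond_entropy A (block \<Xi> {0..<K})"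
        using \<Xi> Aev by (intro joint_entropy_blocks_le) auto
      also have "\<dots> \<le> block_entropy \<Xi> (n + K) + real n * \<delta>"
        using K by (intro add_mono mult_left_mono) (auto simp: block_entropy_def)
      finally show ?thesis using lower by (simp add: block_entropy_def)
    qed
    have le: "block_entropy {A} n / real n \<le>
        block_entropy \<Xi> (n + K) / real (n + K) * (real (n + K) / real n) - ?\<eta> + 2 * \<delta>" if "n \<ge> 1" for n
    proof -
      have "block_entropy \<Xi> (n + K) / real (n + K) * (real (n + K) / real n) = block_entropy \<Xi> (n + K) / real n"
        using that by (simp del: of_nat_add)
      then show ?thesis using bound[of n] that by (simp add: field_simps)
    qed
    have "entropy_rate {A} \<le> ?\<eta> * 1 - ?\<eta> + 2 * \<delta>"
    proof (rule LIMSEQ_le)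
      show "(\<lambda>n. block_entropy {A} n / real n) \<longlonglongrightarrow> entropy_rate {A}"
        using Aev by (intro block_entropy_LIMSEQ) auto
      have "(\<lambda>n. real (n + K) / real n) \<longlonglongrightarrow> 1" by real_asymp
      then show "(\<lambda>n. block_entropy \<Xi> (n + K) / real (n + K) * (real (n + K) / real n) - ?\<eta> + 2 * \<delta>)
          \<longlonglongrightarrow> ?\<eta> * 1 - ?\<eta> + 2 * \<delta>"
        by (intro tendsto_intros LIMSEQ_ignore_initial_segment[OF block_entropy_LIMSEQ[OF \<Xi>]])
    qed (use le in blast)
    then show ?thesis by simp
  qed
  then have "entropy_rate {A} / 2 \<le> 0" by (rule field_le_epsilon)
  then show ?thesis using entropy_rate_nonneg[of "{A}"] Aev by simp
qed

end

section \<open>Decorrelation from the remote future\<close>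

lemma (in prob_space) L1_le_L2:
  fixes f :: "'a \<Rightarrow> real"
  assumes "integrable M f" "integrable M (\<lambda>x. (f x)\<^sup>2)"
  shows "(\<integral>x. \<bar>f x\<bar> \<partial>M)\<^sup>2 \<le> (\<integral>x. (f x)\<^sup>2 \<partial>M)"
  using variance_eq[of "\<lambda>x. \<bar>f x\<bar>"] variance_positive[of "\<lambda>x. \<bar>f x\<bar>"] assms by simp

lemma (in prob_space) real_cond_exp_bounded:
  assumes "subalgebra M F" "f \<in> borel_measurable M" "AE x in M. \<bar>f x\<bar> \<le> C"
  shows "AE x in M. \<bar>real_cond_exp M F f x\<bar> \<le> C"
proof -
  interpret finite_measure_subalgebra M F by standard (rule assms)
  have int: "integrable M f"
    by (rule integrable_const_bound[of _ C]) (use assms in auto)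
  have "AE x in M. f x \<le> C" "AE x in M. - C \<le> f x"
    using assms(3) by auto
  from real_cond_exp_le_c[OF int this(1)] real_cond_exp_ge_c[OF int this(2)]
  show ?thesis by eventually_elim auto
qed

text \<open>
  Against an \<open>F\<close>-measurable function, \<open>v\<close> can be replaced by its conditional expectation.
\<close>

lemma (in prob_space) integral_mult_le_cond_exp:
  assumes "subalgebra M F" "g \<in> borel_measurable F" "\<And>x. x \<in> space M \<Longrightarrow> \<bar>g x\<bar> \<le> K"
    and "v \<in> borel_measurable M" "AE x in M. \<bar>v x\<bar> \<le> C"
  shows "\<bar>\<integral>x. v x * g x \<partial>M\<bar> \<le> K * (\<integral>x. \<bar>real_cond_exp M F v x\<bar> \<partial>M)"
proof -
  interpret finite_measure_subalgebra M F by standard (rule assms)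
  note [measurable] = assms(4) measurable_from_subalg[OF assms(1,2)]
  have int: "integrable M v"
    by (rule integrable_const_bound[of _ C]) (use assms in auto)
  have "AE x in M. \<bar>g x * v x\<bar> \<le> K * C"
    using assms(5)
  proof (rule AE_mp, intro AE_I2 impI)
    fix x assume "x \<in> space M" "\<bar>v x\<bar> \<le> C"
    then show "\<bar>g x * v x\<bar> \<le> K * C"
      using assms(3)[of x] unfolding abs_mult by (intro mult_mono) auto
  qed
  then have gv: "integrable M (\<lambda>x. g x * v x)"
    by (intro integrable_const_bound[of _ "K * C"]) auto
  have "(\<integral>x. v x * g x \<partial>M) = (\<integral>x. g x * real_cond_exp M F v x \<partial>M)"
    using real_cond_exp_intg(2)[OF gv assms(2,4)] by (simp add: mult.commute)
  also have "\<bar>\<dots>\<bar> \<le> (\<integral>x. \<bar>g x * real_cond_exp M F v x\<bar> \<partial>M)"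
    by (rule integral_abs_bound)
  also have "\<dots> \<le> (\<integral>x. K * \<bar>real_cond_exp M F v x\<bar> \<partial>M)"
  proof (rule integral_mono)
    show "integrable M (\<lambda>x. \<bar>g x * real_cond_exp M F v x\<bar>)"
      using real_cond_exp_intg(1)[OF gv assms(2,4)] by auto
    show "integrable M (\<lambda>x. K * \<bar>real_cond_exp M F v x\<bar>)"
      using real_cond_exp_int(1)[OF int] by auto
  qed (use assms(3) in \<open>auto simp: abs_mult intro!: mult_right_mono\<close>)
  also have "\<dots> = K * (\<integral>x. \<bar>real_cond_exp M F v x\<bar> \<partial>M)" by simp
  finally show ?thesis .
qed

context measure_preserving_system
begin

text \<open>
  The conditional expectations \<open>h n\<close> are orthogonal projections of \<open>v\<close> onto decreasing subspaces, so
  their norms decrease and \<open>h\<close> is a Cauchy sequence in mean square. Its limit is measurable with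
  respect to every future, hence with respect to the Pinsker algebra, and therefore
  orthogonal to \<open>v\<close>. The squared norms of \<open>h n\<close> are the inner products of \<open>h n\<close> with \<open>v\<close>, so they tend
  to \<open>0\<close>.
\<close>

lemma cond_exp_future_LIMSEQ:
  assumes \<Xi>: "\<Xi> \<subseteq> events" "finite \<Xi>"
    and v [measurable]: "v \<in> borel_measurable M" and C: "AE x in M. \<bar>v x\<bar> \<le> C"
    and orth: "AE x in M. real_cond_exp M (pinsker_algebra M T) v x = 0"
  shows "(\<lambda>n. \<integral>x. \<bar>real_cond_exp M (future \<Xi> n) v x\<bar> \<partial>M) \<longlonglongrightarrow> 0"
proof -
  note sub = subalgebra_future[OF \<Xi>(1)]
  define h where "h = (\<lambda>n. real_cond_exp M (future \<Xi> n) v)"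
  have h_future: "h n \<in> borel_measurable (future \<Xi> n)" for n
    unfolding h_def by simp
  have h_future_mono: "h n \<in> borel_measurable (future \<Xi> m)" if "m \<le> n" for m n
  proof (rule measurable_from_subalg[OF _ h_future])
    show "subalgebra (future \<Xi> m) (future \<Xi> n)"
      using sets_future_mono[OF \<Xi>(1) order.refl that] by (simp add: subalgebra_def space_future[OF \<Xi>(1)])
  qed
  have h_M [measurable]: "h n \<in> borel_measurable M" for n
    by (rule measurable_from_subalg[OF sub h_future])
  have hC: "AE x in M. \<bar>h n x\<bar> \<le> C" for n
    unfolding h_def by (rule real_cond_exp_bounded[OF sub v C])
  have prod_bd: "AE x in M. norm (p x * q x :: real) \<le> C * C"
    if "AE x in M. \<bar>p x\<bar> \<le> C" "AE x in M. \<bar>q x\<bar> \<le> C" for p q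
    using that by eventually_elim (auto simp: abs_mult intro!: mult_mono)
  have prod_int: "integrable M (\<lambda>x. p x * q x)"
    if "AE x in M. \<bar>p x\<bar> \<le> C" "AE x in M. \<bar>q x\<bar> \<le> C" "p \<in> borel_measurable M" "q \<in> borel_measurable M"
    for p q :: "'a \<Rightarrow> real"
    by (rule integrable_const_bound[OF prod_bd]) (use that in auto)
  have h_int: "integrable M (h n)" for n
    by (rule integrable_const_bound[of _ C]) (use hC in auto)
  define q where "q = (\<lambda>n. \<integral>x. h n x * h n x \<partial>M)"
  have hv: "(\<integral>x. h n x * h m x \<partial>M) = (\<integral>x. h n x * v x \<partial>M)" if "m \<le> n" for m n
  proof -
    interpret finite_measure_subalgebra M "future \<Xi> m" by standard (rule sub)
    show ?thesis
      using real_cond_exp_intg(2)[OF prod_int[OF hC C] h_future_mono[OF that] v]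
      by (simp add: h_def)
  qed
  have q_v: "q n = (\<integral>x. h n x * v x \<partial>M)" for n
    unfolding q_def by (rule hv) simp
  have diff: "(\<integral>x. (h m x - h n x)\<^sup>2 \<partial>M) = q m - q n" if "m \<le> n" for m n
  proof -
    have "(\<integral>x. (h m x - h n x)\<^sup>2 \<partial>M) = (\<integral>x. h m x * h m x - 2 * (h n x * h m x) + h n x * h n x \<partial>M)"
      by (intro Bochner_Integration.integral_cong) (auto simp: power2_eq_square algebra_simps)
    also have "\<dots> = q m - 2 * (\<integral>x. h n x * h m x \<partial>M) + q n"
      using prod_int hC by (simp add: q_def)
    also have "(\<integral>x. h n x * h m x \<partial>M) = q n"
      using hv[OF that] q_v[of n] by simp
    finally show ?thesis by simp
  qed
  have L1: "(\<integral>x. \<bar>h m x - h n x\<bar> \<partial>M)\<^sup>2 \<le> q m - q n" if "m \<le> n" for m n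
  proof -
    have "AE x in M. \<bar>h m x - h n x\<bar> \<le> 2 * C"
      using hC[of m] hC[of n] by eventually_elim auto
    then have "AE x in M. norm ((h m x - h n x)\<^sup>2) \<le> (2 * C)\<^sup>2"
      by eventually_elim (use power_mono[of "\<bar>_\<bar>" "2 * C" 2] in \<open>simp only: real_norm_def power_abs abs_ge_zero\<close>)
    then have "integrable M (\<lambda>x. (h m x - h n x)\<^sup>2)"
      by (rule integrable_const_bound) simp
    then show ?thesis
      using L1_le_L2[of "\<lambda>x. h m x - h n x"] h_int diff[OF that] by simp
  qed
  have "decseq q"
    using L1 by (intro decseq_SucI) (smt (verit, best) le_SucI order_refl zero_le_power2)
  moreover have q0: "0 \<le> q n" for n
    unfolding q_def by (intro integral_nonneg_AE AE_I2) simp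
  ultimately obtain Q where Q: "q \<longlonglongrightarrow> Q"
    by (metis decseq_convergent)
  have cauchy: "\<exists>N. \<forall>i\<ge>N. \<forall>j\<ge>N. (\<integral>x. norm (h i x - h j x) \<partial>M) < e" if "e > 0" for e
  proof -
    have "Cauchy q" using Q by (rule LIMSEQ_imp_Cauchy)
    then obtain N where N: "\<And>i j. i \<ge> N \<Longrightarrow> j \<ge> N \<Longrightarrow> \<bar>q i - q j\<bar> < e\<^sup>2"
      using \<open>e > 0\<close> by (metis Cauchy_def dist_real_def zero_less_power)
    have *: "(\<integral>x. \<bar>h i x - h j x\<bar> \<partial>M) < e" if "i \<ge> N" "i \<le> j" for i j
    proof (rule power2_less_imp_less)
      show "(\<integral>x. \<bar>h i x - h j x\<bar> \<partial>M)\<^sup>2 < e\<^sup>2"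
        using L1[OF that(2)] N[of i j] that by linarith
    qed (use \<open>e > 0\<close> in simp)
    have "(\<integral>x. norm (h i x - h j x) \<partial>M) < e" if "i \<ge> N" "j \<ge> N" for i j
      using *[of i j] *[of j i] that by (cases "i \<le> j") (auto simp: abs_minus_commute)
    then show ?thesis by blast
  qed
  obtain r where r: "strict_mono r" "AE x in M. Cauchy (\<lambda>i. h (r i) x)"
    by (rule cauchy_L1_AE_cauchy_subseq[OF h_int cauchy])
  \<comment> \<open>As a limit depends only on the tail of the sequence, \<open>H\<close> is measurable with respect to the
    future after any time, everywhere and not just almost everywhere.\<close>
  define H where "H = (\<lambda>x. lim (\<lambda>i. h (r i) x))"
  have H_future: "H \<in> borel_measurable (future \<Xi> n)" for n
  proof -
    have "lim (\<lambda>i. h (r (i + n)) x) = H x" for x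
    proof -
      have "(\<lambda>i. h (r (i + n)) x) \<longlonglongrightarrow> y \<longleftrightarrow> (\<lambda>i. h (r i) x) \<longlonglongrightarrow> y" for y
        using LIMSEQ_offset[of "\<lambda>i. h (r i) x" n y] LIMSEQ_ignore_initial_segment[of "\<lambda>i. h (r i) x" y n]
        by blast
      then show ?thesis by (simp add: H_def lim_def)
    qed
    moreover have "(\<lambda>x. lim (\<lambda>i. h (r (i + n)) x)) \<in> borel_measurable (future \<Xi> n)"
      by (intro borel_measurable_lim_metric h_future_mono) (use strict_mono_imp_increasing[OF r(1)] in \<open>meson le_add2 order_trans\<close>)
    ultimately show ?thesis by simp
  qed
  have H_P: "H \<in> borel_measurable (pinsker_algebra M T)"
  proof (rule measurableI)
    fix B :: "real set" assume B: "B \<in> sets borel"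
    let ?A = "H -` B \<inter> space M"
    have "?A \<in> sets (future \<Xi> n)" for n
      using measurable_sets[OF H_future B] by (simp add: space_future \<Xi>)
    then have "entropy_rate {?A} = 0" "?A \<in> events"
      using remote_future_zero_entropy[OF \<Xi>] sets_future_events[OF \<Xi>(1)] by auto
    then show "H -` B \<inter> space (pinsker_algebra M T) \<in> sets (pinsker_algebra M T)"
      by (simp add: space_pinsker_algebra sets_pinsker_algebra)
  qed simp
  have H_M [measurable]: "H \<in> borel_measurable M"
    by (rule measurable_from_subalg[OF subalgebra_pinsker H_P])
  have lim: "AE x in M. (\<lambda>i. h (r i) x) \<longlonglongrightarrow> H x"
    using r(2) by eventually_elim (simp add: H_def Cauchy_convergent_iff convergent_LIMSEQ_iff)
  have HC: "AE x in M. \<bar>H x\<bar> \<le> C"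
  proof -
    have "AE x in M. \<forall>i. \<bar>h (r i) x\<bar> \<le> C"
      unfolding AE_all_countable using hC by blast
    with lim show ?thesis
      by eventually_elim (auto intro: LIMSEQ_le_const2[OF tendsto_rabs])
  qed
  have "(\<integral>x. H x * v x \<partial>M) = 0"
  proof -
    interpret finite_measure_subalgebra M "pinsker_algebra M T" by standard (rule subalgebra_pinsker)
    have "(\<integral>x. H x * v x \<partial>M) = (\<integral>x. H x * real_cond_exp M (pinsker_algebra M T) v x \<partial>M)"
      by (rule real_cond_exp_intg(2)[OF prod_int[OF HC C] H_P v, symmetric]) auto
    also have "\<dots> = (\<integral>x. 0 \<partial>M)"
      using orth by (intro integral_cong_AE) auto
    finally show ?thesis by simp
  qed
  moreover have "(\<lambda>i. \<integral>x. h (r i) x * v x \<partial>M) \<longlonglongrightarrow> (\<integral>x. H x * v x \<partial>M)"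
  proof (rule integral_dominated_convergence)
    show "AE x in M. (\<lambda>i. h (r i) x * v x) \<longlonglongrightarrow> H x * v x"
      using lim by eventually_elim (intro tendsto_intros)
    show "AE x in M. norm (h (r i) x * v x) \<le> C * C" for i
      by (rule prod_bd[OF hC C])
  qed auto
  ultimately have "(q \<circ> r) \<longlonglongrightarrow> 0"
    by (simp add: q_v comp_def)
  moreover have "(q \<circ> r) \<longlonglongrightarrow> Q"
    using Q r(1) by (rule LIMSEQ_subseq_LIMSEQ)
  ultimately have "Q = 0" using LIMSEQ_unique by blast
  then have sqrt_q: "(\<lambda>n. sqrt (q n)) \<longlonglongrightarrow> 0"
    using tendsto_real_sqrt[OF Q] by simp
  have "norm (\<integral>x. \<bar>h n x\<bar> \<partial>M) \<le> sqrt (q n)" for n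
    using L1_le_L2[OF h_int, of n] prod_int[OF hC hC, of n n]
    by (intro real_le_rsqrt) (simp add: q_def power2_eq_square)
  then have "(\<lambda>n. \<integral>x. \<bar>h n x\<bar> \<partial>M) \<longlonglongrightarrow> 0"
    by (intro Lim_null_comparison[OF always_eventually sqrt_q] allI)
  then show ?thesis by (simp only: h_def)
qed

definition T_inv :: "'a \<Rightarrow> 'a" where
  "T_inv = inv_into (space M) T"

lemma T_inv_pow_space: "x \<in> space M \<Longrightarrow> (T_inv ^^ k) x \<in> space M"
  using measurable_space[OF measurable_compose_n[OF T_inv_measurable]] by (simp add: T_inv_def)

lemma T_pow_T_inv_pow: "x \<in> space M \<Longrightarrow> (T ^^ k) ((T_inv ^^ k) x) = x"
proof (induction k arbitrary: x)
  case (Suc k)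
  have "T (T_inv y) = y" if "y \<in> space M" for y
    unfolding T_inv_def using that T_bij by (intro f_inv_into_f) (simp add: bij_betw_def)
  moreover have "(T ^^ Suc k) ((T_inv ^^ Suc k) x) = (T ^^ k) (T (T_inv ((T_inv ^^ k) x)))"
    by (simp add: funpow_swap1)
  ultimately show ?case
    using Suc T_inv_pow_space by simp
qed simp

lemma T_inv_pow_T_pow:
  assumes "x \<in> space M"
  shows "(T_inv ^^ k) ((T ^^ k) x) = x"
proof -
  have "bij_betw (T ^^ k) (space M) (space M)"
    using T_bij by (rule bij_betw_funpow)
  then have "inj_on (T ^^ k) (space M)" by (simp add: bij_betw_def)
  moreover have "(T ^^ k) ((T_inv ^^ k) ((T ^^ k) x)) = (T ^^ k) x"
    using assms by (intro T_pow_T_inv_pow T_pow_space)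
  ultimately show ?thesis
    using assms T_inv_pow_space T_pow_space by (auto dest: inj_onD)
qed

text \<open>
  Together with invariance of \<open>M\<close> this transports a statement about the future after time \<open>k + n\<close>
  to the future after time \<open>n\<close>, which makes the next estimates uniform in \<open>k\<close>.
\<close>

lemma T_inv_pow_future:
  assumes "\<Xi> \<subseteq> events"
  shows "T_inv ^^ k \<in> future \<Xi> n \<rightarrow>\<^sub>M future \<Xi> (k + n)"
proof (rule measurable_sigma_sets[OF sets_future future_generators_Pow])
  fix B assume B: "B \<in> block \<Xi> {k + n..} \<union> null_sets M"
  have "(T_inv ^^ k) -` B \<inter> space M \<in> block \<Xi> {n..} \<union> null_sets M"
  proof (cases "B \<in> null_sets M")
    case True
    let ?N = "(T_inv ^^ k) -` B \<inter> space M"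
    have N: "?N \<in> events"
      using True T_inv_measurable
      by (intro measurable_sets[OF measurable_compose_n]) (auto simp: T_inv_def)
    have "B \<subseteq> space M"
      using True by (intro sets.sets_into_space null_setsD2)
    then have "pullback k ?N = B"
      by (auto simp: pullback_def T_pow_space T_inv_pow_T_pow subset_iff)
    then have "prob ?N = prob B" using prob_pullback[OF N, of k] by simp
    then show ?thesis
      using N True by (auto simp: null_sets_def emeasure_eq_measure)
  next
    case False
    then obtain i A where i: "i \<ge> k + n" "A \<in> \<Xi>" "B = pullback i A"
      using B by (auto simp: block_def)
    have "(T_inv ^^ k) -` B \<inter> space M = pullback (i - k) A"
    proof -
      have "(T ^^ i) ((T_inv ^^ k) x) = (T ^^ (i - k)) x" if "x \<in> space M" for x
        using i(1) T_pow_T_inv_pow[OF that, of k] funpow_add[of "i - k" k T] by simp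
      then show ?thesis using T_inv_pow_space by (auto simp: i(3) pullback_def)
    qed
    then show ?thesis using i by (auto simp: block_def intro!: bexI[of _ "i - k"])
  qed
  then show "(T_inv ^^ k) -` B \<inter> space (future \<Xi> n) \<in> sets (future \<Xi> n)"
    using future_generator assms by (simp add: space_future)
qed (use assms T_inv_pow_space space_future in auto)

lemma integral_T_pow:
  fixes g :: "'a \<Rightarrow> 'b :: {banach, second_countable_topology}"
  assumes "g \<in> borel_measurable M"
  shows "(\<integral>x. g ((T ^^ k) x) \<partial>M) = (\<integral>x. g x \<partial>M)"
  using integral_distr[OF T_pow_measurable assms, of k] by (simp add: distr_T_pow)

lemma AE_T_pow: "AE x in M. P x \<Longrightarrow> AE x in M. P ((T ^^ k) x)"
  by (rule AE_distrD[OF T_pow_measurable]) (simp only: distr_T_pow)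

text \<open>
  Moving \<open>u\<close> back to time \<open>0\<close> by invariance turns \<open>F\<close> into a function measurable with respect to the future
  after time \<open>L\<close>. The integral is then at most a constant times the mean absolute values of the
  conditional expectations of the real and imaginary parts of \<open>u\<close>.
\<close>

lemma future_decorrelation:
  fixes u :: "'a \<Rightarrow> complex"
  assumes \<Xi>: "\<Xi> \<subseteq> events" "finite \<Xi>"
    and u [measurable]: "u \<in> borel_measurable M" and C: "AE x in M. cmod (u x) \<le> C"
    and orth: "AE x in M. complex_cond_exp M (pinsker_algebra M T) u x = 0"
    and "\<epsilon> > 0"
  shows "\<exists>L. \<forall>s. \<forall>F\<in>borel_measurable (future \<Xi> (s + L)).
      (\<forall>x\<in>space M. cmod (F x) \<le> K) \<longrightarrow> cmod (\<integral>x. u ((T ^^ s) x) * F x \<partial>M) \<le> \<epsilon>"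
proof -
  let ?e = "\<lambda>v n. \<integral>x. \<bar>real_cond_exp M (future \<Xi> n) v x\<bar> \<partial>M"
  have bd: "AE x in M. \<bar>Re (u x)\<bar> \<le> C" "AE x in M. \<bar>Im (u x)\<bar> \<le> C"
    using C by (auto elim!: eventually_mono intro: order_trans[OF abs_Re_le_cmod] order_trans[OF abs_Im_le_cmod])
  have "AE x in M. real_cond_exp M (pinsker_algebra M T) (\<lambda>x. Re (u x)) x = 0"
       "AE x in M. real_cond_exp M (pinsker_algebra M T) (\<lambda>x. Im (u x)) x = 0"
    using orth by (auto simp: complex_cond_exp_def complex_eq_iff)
  then have "(\<lambda>n. 2 * K * (?e (\<lambda>x. Re (u x)) n + ?e (\<lambda>x. Im (u x)) n)) \<longlonglongrightarrow> 2 * K * (0 + 0)"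
    using bd by (intro tendsto_intros cond_exp_future_LIMSEQ \<Xi>) auto
  then have "\<forall>\<^sub>F n in sequentially. 2 * K * (?e (\<lambda>x. Re (u x)) n + ?e (\<lambda>x. Im (u x)) n) < \<epsilon>"
    using \<open>\<epsilon> > 0\<close> by (intro order_tendstoD) auto
  then obtain L where L: "2 * K * (?e (\<lambda>x. Re (u x)) L + ?e (\<lambda>x. Im (u x)) L) < \<epsilon>"
    by (auto simp: eventually_sequentially)
  show ?thesis
  proof (intro exI[of _ L] allI ballI impI)
    fix s F
    assume F: "F \<in> borel_measurable (future \<Xi> (s + L))" and K: "\<forall>x\<in>space M. cmod (F x) \<le> K"
    define G where "G = (\<lambda>x. F ((T_inv ^^ s) x))"
    have G: "G \<in> borel_measurable (future \<Xi> L)"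
      unfolding G_def by (rule measurable_compose[OF T_inv_pow_future[OF \<Xi>(1)] F])
    have G_M [measurable]: "G \<in> borel_measurable M"
      by (rule measurable_from_subalg[OF subalgebra_future[OF \<Xi>(1)] G])
    have GK: "cmod (G x) \<le> K" if "x \<in> space M" for x
      using that by (simp add: G_def K T_inv_pow_space)
    then have GK': "\<bar>Re (G x)\<bar> \<le> K" "\<bar>Im (G x)\<bar> \<le> K" if "x \<in> space M" for x
      using that by (meson abs_Re_le_cmod abs_Im_le_cmod order_trans)+
    have "(\<integral>x. u ((T ^^ s) x) * F x \<partial>M) = (\<integral>x. u ((T ^^ s) x) * G ((T ^^ s) x) \<partial>M)"
      by (intro Bochner_Integration.integral_cong) (auto simp: G_def T_inv_pow_T_pow)
    also have "\<dots> = (\<integral>x. u x * G x \<partial>M)"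
      by (rule integral_T_pow) auto
    finally have eq: "(\<integral>x. u ((T ^^ s) x) * F x \<partial>M) = (\<integral>x. u x * G x \<partial>M)" .
    have "AE x in M. cmod (u x * G x) \<le> C * K"
      using C
    proof (rule AE_mp, intro AE_I2 impI)
      fix x assume "x \<in> space M" "cmod (u x) \<le> C"
      then show "cmod (u x * G x) \<le> C * K"
        unfolding norm_mult using GK[of x] order_trans[OF norm_ge_zero[of "u x"], of C]
        by (intro mult_mono) auto
    qed
    then have int: "integrable M (\<lambda>x. u x * G x)"
      by (rule integrable_const_bound) simp
    have intp: "integrable M (\<lambda>x. p x * q x)"
      if "AE x in M. \<bar>p x\<bar> \<le> C" "\<And>x. x \<in> space M \<Longrightarrow> \<bar>q x\<bar> \<le> K" "p \<in> borel_measurable M" "q \<in> borel_measurable M"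
      for p q :: "'a \<Rightarrow> real"
    proof (rule integrable_const_bound)
      show "AE x in M. norm (p x * q x) \<le> C * K"
        using that(1)
      proof (rule AE_mp, intro AE_I2 impI)
        fix x assume "x \<in> space M" "\<bar>p x\<bar> \<le> C"
        then show "norm (p x * q x) \<le> C * K"
          using that(2)[of x] by (auto simp: abs_mult intro!: mult_mono)
      qed
    qed (use that in auto)
    let ?I = "\<lambda>p q. \<integral>x. p (u x) * q (G x) \<partial>M"
    have I: "\<bar>?I p q\<bar> \<le> K * ?e (\<lambda>x. p (u x)) L" if "p \<in> {Re, Im}" "q \<in> {Re, Im}" for p q
      using that bd GK' G
      by (intro integral_mult_le_cond_exp[OF subalgebra_future[OF \<Xi>(1)], where C=C]) auto
    have "cmod (\<integral>x. u x * G x \<partial>M) \<le> \<bar>Re (\<integral>x. u x * G x \<partial>M)\<bar> + \<bar>Im (\<integral>x. u x * G x \<partial>M)\<bar>"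
      by (rule cmod_le)
    also have "Re (\<integral>x. u x * G x \<partial>M) = (\<integral>x. Re (u x) * Re (G x) - Im (u x) * Im (G x) \<partial>M)"
      using integral_Re[OF int] by simp
    also have "\<dots> = ?I Re Re - ?I Im Im"
      using bd GK' by (intro Bochner_Integration.integral_diff intp) auto
    also have "Im (\<integral>x. u x * G x \<partial>M) = (\<integral>x. Re (u x) * Im (G x) + Im (u x) * Re (G x) \<partial>M)"
      using integral_Im[OF int] by simp
    also have "\<dots> = ?I Re Im + ?I Im Re"
      using bd GK' by (intro Bochner_Integration.integral_add intp) auto
    finally have "cmod (\<integral>x. u x * G x \<partial>M) \<le> \<bar>?I Re Re\<bar> + \<bar>?I Im Im\<bar> + \<bar>?I Re Im\<bar> + \<bar>?I Im Re\<bar>"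
      by linarith
    also have "\<dots> \<le> 2 * K * (?e (\<lambda>x. Re (u x)) L + ?e (\<lambda>x. Im (u x)) L)"
      using I[of Re Re] I[of Im Im] I[of Re Im] I[of Im Re] by (simp add: algebra_simps)
    finally show "cmod (\<integral>x. u ((T ^^ s) x) * F x \<partial>M) \<le> \<epsilon>"
      using L eq by simp
  qed
qed

end

section \<open>Bounded functions\<close>

lemma (in prob_space) Linf_nonneg_bound:
  "f \<in> Linf M \<Longrightarrow> \<exists>C\<ge>0. AE x in M. cmod (f x) \<le> C"
proof -
  assume "f \<in> Linf M"
  then obtain C where "AE x in M. cmod (f x) \<le> C" by (auto simp: Linf_def)
  then have "AE x in M. cmod (f x) \<le> max 0 C" by eventually_elim auto
  then show ?thesis by (intro exI[of _ "max 0 C"]) auto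
qed

lemma Linf_measurable [measurable_dest]: "f \<in> Linf M \<Longrightarrow> f \<in> borel_measurable M"
  by (simp add: Linf_def)

lemma LinfI: "f \<in> borel_measurable M \<Longrightarrow> AE x in M. cmod (f x) \<le> C \<Longrightarrow> f \<in> Linf M"
  by (auto simp: Linf_def)

context prob_space
begin

lemma Linf_const: "(\<lambda>x. c) \<in> Linf M"
  by (rule LinfI[of _ _ "cmod c"]) auto

lemma Linf_add:
  assumes "f \<in> Linf M" "g \<in> Linf M"
  shows "(\<lambda>x. f x + g x) \<in> Linf M"
proof -
  obtain C D where "AE x in M. cmod (f x) \<le> C" "AE x in M. cmod (g x) \<le> D"
    using assms by (auto simp: Linf_def)
  then have "AE x in M. cmod (f x + g x) \<le> C + D"
    by eventually_elim (rule norm_triangle_mono)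
  then show ?thesis using assms by (intro LinfI) auto
qed

lemma Linf_mult:
  assumes "f \<in> Linf M" "g \<in> Linf M"
  shows "(\<lambda>x. f x * g x) \<in> Linf M"
proof -
  obtain C D where CD: "AE x in M. cmod (f x) \<le> C" "AE x in M. cmod (g x) \<le> D" and "C \<ge> 0"
    using Linf_nonneg_bound[OF assms(1)] Linf_nonneg_bound[OF assms(2)] by blast
  from CD have "AE x in M. cmod (f x * g x) \<le> C * D"
    by eventually_elim (auto simp: norm_mult intro!: mult_mono \<open>C \<ge> 0\<close>)
  then show ?thesis using assms by (intro LinfI) auto
qed

lemma Linf_cnj:
  assumes "f \<in> Linf M"
  shows "(\<lambda>x. cnj (f x)) \<in> Linf M"
proof -
  have "(\<lambda>x. cnj (f x)) \<in> borel_measurable M"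
    using assms by (intro borel_measurable_continuous_on[of cnj]) (auto intro: continuous_intros)
  with assms show ?thesis by (simp add: Linf_def)
qed

lemma Linf_sum: "(\<And>i. i \<in> I \<Longrightarrow> f i \<in> Linf M) \<Longrightarrow> (\<lambda>x. \<Sum>i\<in>I. f i x) \<in> Linf M"
  by (induction I rule: infinite_finite_induct) (auto intro: Linf_const Linf_add)

lemma Linf_prod: "(\<And>i. i \<in> I \<Longrightarrow> f i \<in> Linf M) \<Longrightarrow> (\<lambda>x. \<Prod>i\<in>I. f i x) \<in> Linf M"
  by (induction I rule: infinite_finite_induct) (auto intro: Linf_const Linf_mult)

lemma Linf_diff: "f \<in> Linf M \<Longrightarrow> g \<in> Linf M \<Longrightarrow> (\<lambda>x. f x - g x) \<in> Linf M"
  using Linf_add[OF _ Linf_mult[OF Linf_const[of "-1"]], of f g] by simp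

lemma Linf_integrable: "f \<in> Linf M \<Longrightarrow> integrable M f"
  by (auto simp: Linf_def intro: integrable_const_bound)

lemma Linf_norm_integrable: "f \<in> Linf M \<Longrightarrow> integrable M (\<lambda>x. (cmod (f x))\<^sup>2)"
  using integrable_Re[OF Linf_integrable[OF Linf_mult[OF _ Linf_cnj], of f f]]
  unfolding cmod_power2 by (simp add: power2_eq_square)

lemma bounded_simple_approx:
  fixes g :: "'a \<Rightarrow> complex"
  assumes N: "subalgebra M N" and g: "g \<in> borel_measurable N" and C: "AE x in M. cmod (g x) \<le> C"
    and "C \<ge> 0" "\<delta> > 0"
  obtains G where "simple_function N G" "\<And>x. x \<in> space M \<Longrightarrow> cmod (G x) \<le> 2 * C"
    "(\<integral>x. cmod (g x - G x) \<partial>M) < \<delta>"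
proof -
  define g' where "g' = (\<lambda>x. if cmod (g x) \<le> C then g x else 0)"
  have g': "g' \<in> borel_measurable N" unfolding g'_def using g by measurable
  have sp: "space N = space M" using N by (simp add: subalgebra_def)
  obtain F where F: "\<And>i. simple_function N (F i)" "\<And>x. x \<in> space N \<Longrightarrow> (\<lambda>i. F i x) \<longlonglongrightarrow> g' x"
      "\<And>i x. x \<in> space N \<Longrightarrow> dist (F i x) 0 \<le> 2 * dist (g' x) 0"
    using borel_measurable_implies_sequence_metric[OF g', of 0] by blast
  have F_M [measurable]: "F i \<in> borel_measurable M" for i
    by (rule measurable_from_subalg[OF N borel_measurable_simple_function[OF F(1)]])
  have g_M [measurable]: "g \<in> borel_measurable M"
    by (rule measurable_from_subalg[OF N g])
  have F_bd: "cmod (F i x) \<le> 2 * C" if "x \<in> space M" for i x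
    using F(3)[of x i] that \<open>C \<ge> 0\<close> by (auto simp: sp g'_def split: if_splits)
  have "(\<lambda>i. \<integral>x. cmod (g x - F i x) \<partial>M) \<longlonglongrightarrow> (\<integral>x. 0 \<partial>M)"
  proof (rule integral_dominated_convergence[where w = "\<lambda>x. 3 * C"])
    show "AE x in M. (\<lambda>i. cmod (g x - F i x)) \<longlonglongrightarrow> 0"
      using C
    proof (rule AE_mp, intro AE_I2 impI)
      fix x assume "x \<in> space M" "cmod (g x) \<le> C"
      then have "(\<lambda>i. F i x) \<longlonglongrightarrow> g x" using F(2)[of x] by (simp add: sp g'_def)
      then have "(\<lambda>i. cmod (g x - F i x)) \<longlonglongrightarrow> cmod (g x - g x)"
        by (intro tendsto_intros)
      then show "(\<lambda>i. cmod (g x - F i x)) \<longlonglongrightarrow> 0" by simp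
    qed
    show "AE x in M. norm (cmod (g x - F i x)) \<le> 3 * C" for i
      using C
    proof (rule AE_mp, intro AE_I2 impI)
      fix x assume "x \<in> space M" "cmod (g x) \<le> C"
      then show "norm (cmod (g x - F i x)) \<le> 3 * C"
        using F_bd[of x i] norm_triangle_ineq4[of "g x" "F i x"] by simp
    qed
  qed auto
  then have "\<forall>\<^sub>F i in sequentially. (\<integral>x. cmod (g x - F i x) \<partial>M) < \<delta>"
    using \<open>\<delta> > 0\<close> by (intro order_tendstoD) auto
  then obtain i where "(\<integral>x. cmod (g x - F i x) \<partial>M) < \<delta>"
    by (auto simp: eventually_sequentially)
  then show thesis using F(1) F_bd by (intro that[of "F i"])
qed

section \<open>Mean square of averages\<close>

text \<open>
  The mean square of the average is the mean of the correlations over all pairs of indices. A correlation is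
  small unless one of the indices is below \<open>n0\<close> or the two times are close, and such pairs have
  density \<open>0\<close>.
\<close>

lemma average_tendsto_0:
  fixes F :: "nat \<Rightarrow> 'a \<Rightarrow> complex" and a :: "nat \<Rightarrow> nat"
  assumes F: "\<And>n. F n \<in> borel_measurable M" and C: "\<And>n. AE x in M. cmod (F n x) \<le> C" and "C \<ge> 0"
    and spread: "\<And>L::real. L > 0 \<Longrightarrow>
       (\<lambda>N. real (card {(m, n). m \<in> {1..N} \<and> n \<in> {1..N} \<and> \<bar>real (a m) - real (a n)\<bar> \<le> L}) / (real N)\<^sup>2)
          \<longlonglongrightarrow> 0"
    and decor: "\<And>\<epsilon>. \<epsilon> > 0 \<Longrightarrow> \<exists>L n0. \<forall>m\<ge>n0. \<forall>n\<ge>n0. a m + L \<le> a n \<longrightarrow>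
        cmod (\<integral>x. F m x * cnj (F n x) \<partial>M) \<le> \<epsilon>"
  shows "(\<lambda>N. \<integral>x. (cmod ((1 / of_nat N) * (\<Sum>n=1..N. F n x)))\<^sup>2 \<partial>M) \<longlonglongrightarrow> 0"
proof -
  define c where "c = (\<lambda>m n. \<integral>x. F m x * cnj (F n x) \<partial>M)"
  have FL: "F n \<in> Linf M" for n
    using F C by (rule LinfI)
  have int: "integrable M (\<lambda>x. F m x * cnj (F n x))" for m n
    by (intro Linf_integrable Linf_mult Linf_cnj FL)
  have c_bd: "cmod (c m n) \<le> C\<^sup>2" for m n
  proof -
    have "cmod (c m n) \<le> (\<integral>x. cmod (F m x * cnj (F n x)) \<partial>M)"
      unfolding c_def by (rule integral_norm_bound)
    also have "\<dots> \<le> (\<integral>x. C\<^sup>2 \<partial>M)"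
    proof (rule integral_mono_AE)
      show "AE x in M. cmod (F m x * cnj (F n x)) \<le> C\<^sup>2"
        using C[of m] C[of n]
        by eventually_elim (auto simp: norm_mult power2_eq_square intro!: mult_mono \<open>C \<ge> 0\<close>)
    qed (use int in auto)
    finally show ?thesis by (simp add: prob_space)
  qed
  have c_commute: "cmod (c m n) = cmod (c n m)" for m n
  proof -
    have "c m n = (\<integral>x. cnj (F n x * cnj (F m x)) \<partial>M)"
      unfolding c_def by (simp add: mult.commute)
    also have "\<dots> = cnj (c n m)" unfolding c_def by (rule Bochner_Integration.integral_cnj)
    finally show ?thesis by simp
  qed
  define V where "V = (\<lambda>N. \<integral>x. (cmod ((1 / of_nat N) * (\<Sum>n=1..N. F n x)))\<^sup>2 \<partial>M)"
  have V_le: "V N \<le> (\<Sum>m=1..N. \<Sum>n=1..N. cmod (c m n)) / (real N)\<^sup>2" for N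
  proof -
    have sq: "(cmod (\<Sum>n=1..N. F n x))\<^sup>2 = Re (\<Sum>m=1..N. \<Sum>n=1..N. F m x * cnj (F n x))" for x
    proof -
      have "(\<Sum>m=1..N. \<Sum>n=1..N. F m x * cnj (F n x)) = (\<Sum>n=1..N. F n x) * cnj (\<Sum>n=1..N. F n x)"
        by (simp add: sum_product cnj_sum)
      also have "\<dots> = complex_of_real ((cmod (\<Sum>n=1..N. F n x))\<^sup>2)"
        by (rule complex_norm_square[symmetric])
      finally show ?thesis by simp
    qed
    have "V N = (\<integral>x. Re (\<Sum>m=1..N. \<Sum>n=1..N. F m x * cnj (F n x)) / (real N)\<^sup>2 \<partial>M)"
      unfolding V_def sq[symmetric]
      by (simp only: norm_mult norm_divide power_mult_distrib power_divide) simp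
    also have "\<dots> = Re (\<integral>x. (\<Sum>m=1..N. \<Sum>n=1..N. F m x * cnj (F n x)) \<partial>M) / (real N)\<^sup>2"
      by (subst integral_Re[symmetric]) (auto intro!: Bochner_Integration.integrable_sum int)
    also have "(\<integral>x. (\<Sum>m=1..N. \<Sum>n=1..N. F m x * cnj (F n x)) \<partial>M) = (\<Sum>m=1..N. \<Sum>n=1..N. c m n)"
      unfolding c_def using int by (simp add: Bochner_Integration.integral_sum)
    also have "Re \<dots> \<le> cmod \<dots>" by (rule complex_Re_le_cmod)
    also have "cmod (\<Sum>m=1..N. \<Sum>n=1..N. c m n) \<le> (\<Sum>m=1..N. \<Sum>n=1..N. cmod (c m n))"
      by (intro order_trans[OF norm_sum] sum_mono norm_sum)
    finally show ?thesis by (simp add: divide_right_mono)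
  qed
  have "\<exists>N0. \<forall>N\<ge>N0. norm (V N - 0) < r" if r: "r > 0" for r
  proof -
    obtain L n0 where "\<forall>m\<ge>n0. \<forall>n\<ge>n0. a m + L \<le> a n \<longrightarrow> cmod (\<integral>x. F m x * cnj (F n x) \<partial>M) \<le> r / 2"
      using decor[OF half_gt_zero[OF r]] by blast
    then have L: "cmod (c m n) \<le> r / 2" if "m \<ge> n0" "n \<ge> n0" "a m + L \<le> a n" for m n
      using that by (simp add: c_def)
    \<comment> \<open>The bound \<open>L + 1\<close> instead of \<open>L\<close> keeps the radius positive when \<open>L = 0\<close>.\<close>
    define E where "E = (\<lambda>N. {(m, n). m \<in> {1..N} \<and> n \<in> {1..N} \<and> \<bar>real (a m) - real (a n)\<bar> \<le> real L + 1})"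
    have bound: "V N \<le> r / 2 + C\<^sup>2 * (real (card (E N)) / (real N)\<^sup>2 + 2 * real n0 / real N)"
      if "N \<ge> 1" for N
    proof -
      \<comment> \<open>The pairs for which no smallness of the correlation is known.\<close>
      define bad where "bad = {..<n0} \<times> {1..N} \<union> {1..N} \<times> {..<n0} \<union> E N"
      have "E N \<subseteq> {1..N} \<times> {1..N}" by (auto simp: E_def)
      then have fE: "finite (E N)" using finite_subset by blast
      then have fin: "finite bad" by (auto simp: bad_def)
      have "card bad \<le> card ({..<n0} \<times> {1..N} \<union> {1..N} \<times> {..<n0}) + card (E N)"
        unfolding bad_def by (rule card_Un_le)
      also have "card ({..<n0} \<times> {1..N} \<union> {1..N} \<times> {..<n0}) \<le>
          card ({..<n0} \<times> {1..N}) + card ({1..N} \<times> {..<n0})"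
        by (rule card_Un_le)
      finally have card: "card bad \<le> card (E N) + 2 * n0 * N" by (simp add: algebra_simps)
      have le: "cmod (c m n) \<le> r / 2 + C\<^sup>2 * indicator bad (m, n)" if "m \<in> {1..N}" "n \<in> {1..N}" for m n
      proof (cases "(m, n) \<in> bad")
        case True
        then show ?thesis using c_bd[of m n] \<open>r > 0\<close> by simp
      next
        case False
        then have mn: "m \<ge> n0" "n \<ge> n0" "\<bar>real (a m) - real (a n)\<bar> > real L + 1"
          using that by (auto simp: bad_def E_def)
        then consider "a m + L \<le> a n" | "a n + L \<le> a m" by linarith
        then have "cmod (c m n) \<le> r / 2"
          using L[of m n] L[of n m] mn c_commute[of m n] by cases auto
        then show ?thesis using False by simp
      qed
      have "(\<Sum>m=1..N. \<Sum>n=1..N. cmod (c m n)) \<le> (\<Sum>m=1..N. \<Sum>n=1..N. r / 2 + C\<^sup>2 * indicator bad (m, n))"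
        by (intro sum_mono le)
      also have "\<dots> = (real N)\<^sup>2 * (r / 2) + C\<^sup>2 * (\<Sum>p\<in>{1..N} \<times> {1..N}. indicator bad p)"
        by (simp add: sum.distrib sum_distrib_left[symmetric] sum.cartesian_product power2_eq_square case_prod_beta)
      also have "(\<Sum>p\<in>{1..N} \<times> {1..N}. indicator bad p :: real) \<le> (\<Sum>p\<in>{1..N} \<times> {1..N} \<union> bad. indicator bad p)"
        using fin by (intro sum_mono2) auto
      also have "(\<Sum>p\<in>{1..N} \<times> {1..N} \<union> bad. indicator bad p :: real) = (\<Sum>p\<in>bad. 1)"
        using fin by (intro sum.mono_neutral_cong_right) auto
      also have "(\<Sum>p\<in>bad. 1) = real (card bad)" by simp
      also have "real (card bad) \<le> real (card (E N)) + 2 * real n0 * real N"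
        using card by (metis of_nat_add of_nat_le_iff of_nat_mult of_nat_numeral)
      finally have "(\<Sum>m=1..N. \<Sum>n=1..N. cmod (c m n)) \<le>
          (real N)\<^sup>2 * (r / 2) + C\<^sup>2 * (real (card (E N)) + 2 * real n0 * real N)"
        by (simp add: mult_left_mono)
      then have "V N \<le> ((real N)\<^sup>2 * (r / 2) + C\<^sup>2 * (real (card (E N)) + 2 * real n0 * real N)) / (real N)\<^sup>2"
        using V_le[of N] by (meson divide_right_mono order_trans zero_le_power2)
      also have "\<dots> = r / 2 + C\<^sup>2 * (real (card (E N)) / (real N)\<^sup>2 + 2 * real n0 / real N)"
        using that by (simp add: add_divide_distrib power2_eq_square distrib_left)
      finally show ?thesis .
    qed
    have "(\<lambda>N. real (card (E N)) / (real N)\<^sup>2) \<longlonglongrightarrow> 0"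
      unfolding E_def by (rule spread) simp
    moreover have "(\<lambda>N. 2 * real n0 / real N) \<longlonglongrightarrow> 0"
      by (rule lim_const_over_n)
    ultimately have "(\<lambda>N. r / 2 + C\<^sup>2 * (real (card (E N)) / (real N)\<^sup>2 + 2 * real n0 / real N))
        \<longlonglongrightarrow> r / 2 + C\<^sup>2 * (0 + 0)"
      by (intro tendsto_intros)
    then have "\<forall>\<^sub>F N in sequentially. r / 2 + C\<^sup>2 * (real (card (E N)) / (real N)\<^sup>2 + 2 * real n0 / real N) < r"
      by (rule order_tendstoD(2)) (use \<open>r > 0\<close> in auto)
    then obtain N0 where N0: "\<And>N. N \<ge> N0 \<Longrightarrow>
        r / 2 + C\<^sup>2 * (real (card (E N)) / (real N)\<^sup>2 + 2 * real n0 / real N) < r"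
      by (auto simp: eventually_sequentially)
    have "V N < r" if "N \<ge> max 1 N0" for N
      using bound[of N] N0[of N] that by linarith
    moreover have "V N \<ge> 0" for N unfolding V_def by simp
    ultimately show ?thesis by (intro exI[of _ "max 1 N0"]) simp
  qed
  then show ?thesis unfolding V_def by (rule LIMSEQ_I)
qed

end

text \<open>
  Dividing all factors by \<open>B\<close> reduces to factors of norm at most \<open>1\<close>.
\<close>

lemma norm_prod_diff_le:
  fixes z w :: "'i \<Rightarrow> complex"
  assumes "B \<ge> 1" "\<And>i. i \<in> I \<Longrightarrow> norm (z i) \<le> B" "\<And>i. i \<in> I \<Longrightarrow> norm (w i) \<le> B"
  shows "norm ((\<Prod>i\<in>I. z i) - (\<Prod>i\<in>I. w i)) \<le> B ^ card I * (\<Sum>i\<in>I. norm (z i - w i))"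
proof -
  have scale: "(\<Prod>i\<in>I. y i) = of_real B ^ card I * (\<Prod>i\<in>I. y i / of_real B)" for y :: "'i \<Rightarrow> complex"
    using assms(1) by (simp add: prod_dividef)
  have "norm ((\<Prod>i\<in>I. z i) - (\<Prod>i\<in>I. w i)) =
      B ^ card I * norm ((\<Prod>i\<in>I. z i / of_real B) - (\<Prod>i\<in>I. w i / of_real B))"
    using assms(1) by (subst scale[of z], subst scale[of w])
      (simp add: right_diff_distrib[symmetric] norm_mult norm_power)
  also have "norm ((\<Prod>i\<in>I. z i / of_real B) - (\<Prod>i\<in>I. w i / of_real B)) \<le>
      (\<Sum>i\<in>I. norm (z i / of_real B - w i / of_real B))"
    using assms by (intro norm_prod_diff) (auto simp: norm_divide)
  also have "\<dots> \<le> (\<Sum>i\<in>I. norm (z i - w i))"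
  proof (rule sum_mono)
    fix i
    have "norm (z i / of_real B - w i / of_real B) = norm (z i - w i) / B"
      using assms(1) by (simp add: diff_divide_distrib[symmetric] norm_divide)
    also have "\<dots> \<le> norm (z i - w i) / 1"
      using assms(1) by (intro divide_left_mono) auto
    finally show "norm (z i / of_real B - w i / of_real B) \<le> norm (z i - w i)" by simp
  qed
  finally show ?thesis using assms(1) by (simp add: mult_left_mono)
qed

section \<open>Conditional expectation of complex functions\<close>

lemma borel_measurable_complex_cond_exp:
  "complex_cond_exp M F f \<in> borel_measurable F"
  unfolding complex_cond_exp_def Complex_eq
  by measurable

context prob_space
begin

lemma complex_cond_exp_bounded:
  assumes "subalgebra M F" "f \<in> borel_measurable M" "AE x in M. cmod (f x) \<le> C"
  shows "AE x in M. cmod (complex_cond_exp M F f x) \<le> 2 * C"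
proof -
  have parts: "AE x in M. \<bar>Re (f x)\<bar> \<le> C" "AE x in M. \<bar>Im (f x)\<bar> \<le> C"
    using assms(3) by (auto elim!: eventually_mono intro: order_trans[OF abs_Re_le_cmod] order_trans[OF abs_Im_le_cmod])
  have meas: "(\<lambda>x. Re (f x)) \<in> borel_measurable M" "(\<lambda>x. Im (f x)) \<in> borel_measurable M"
    using assms(2) by auto
  from real_cond_exp_bounded[OF assms(1) meas(1) parts(1)]
    real_cond_exp_bounded[OF assms(1) meas(2) parts(2)]
  show ?thesis
  proof eventually_elim
    case (elim x)
    then show ?case
      using cmod_le[of "complex_cond_exp M F f x"] by (simp add: complex_cond_exp_def)
  qed
qed

lemma complex_cond_exp_residual:
  assumes F: "subalgebra M F" and f: "f \<in> borel_measurable M" and C: "AE x in M. cmod (f x) \<le> C"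
  shows "AE x in M. complex_cond_exp M F (\<lambda>x. f x - complex_cond_exp M F f x) x = 0"
proof -
  interpret finite_measure_subalgebra M F by standard (rule F)
  have *: "AE x in M. real_cond_exp M F (\<lambda>x. p x - real_cond_exp M F p x) x = 0"
    if p: "integrable M p" for p
  proof -
    have "AE x in M. real_cond_exp M F (\<lambda>x. p x - real_cond_exp M F p x) x
        = real_cond_exp M F p x - real_cond_exp M F (real_cond_exp M F p) x"
      using p by (intro real_cond_exp_diff real_cond_exp_int)
    moreover have "AE x in M. real_cond_exp M F (real_cond_exp M F p) x = real_cond_exp M F p x"
      using p by (intro real_cond_exp_F_meas real_cond_exp_int) auto
    ultimately show ?thesis by eventually_elim simp
  qed
  have "integrable M f" by (rule integrable_const_bound[OF C f])
  then have "integrable M (\<lambda>x. Re (f x))" "integrable M (\<lambda>x. Im (f x))" by auto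
  from *[OF this(1)] *[OF this(2)] show ?thesis
    by eventually_elim (simp add: complex_cond_exp_def complex_eq_iff)
qed

end

section \<open>Correlations\<close>

context measure_preserving_system
begin

lemma Linf_T_pow:
  assumes "f \<in> Linf M"
  shows "(\<lambda>x. f ((T ^^ k) x)) \<in> Linf M"
proof -
  obtain C where "AE x in M. cmod (f x) \<le> C" using assms by (auto simp: Linf_def)
  from AE_T_pow[OF this] show ?thesis
    using assms by (intro LinfI) (auto intro: measurable_compose[OF T_pow_measurable])
qed

text \<open>
  When \<open>G\<close> is Pinsker measurable its level sets have zero entropy, and their preimages lie in the future
  after any time, whatever \<open>k\<close> is.
\<close>

lemma simple_function_T_pow_future:
  assumes \<Xi>: "\<Xi> \<subseteq> events"
    and G: "simple_function N G" "space N = space M"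
    and lev: "\<And>y. y \<in> G ` space M \<Longrightarrow> G -` {y} \<inter> space M \<in> \<Xi>"
    and k: "n \<le> k \<or> sets N \<subseteq> sets (pinsker_algebra M T)"
  shows "(\<lambda>x. G ((T ^^ k) x)) \<in> borel_measurable (future \<Xi> n)"
proof (rule borel_measurable_simple_function, unfold simple_function_def, intro conjI ballI)
  have sub: "(\<lambda>x. G ((T ^^ k) x)) ` space (future \<Xi> n) \<subseteq> G ` space M"
    using T_pow_space by (auto simp: space_future[OF \<Xi>])
  moreover have "finite (G ` space M)"
    using simple_functionD(1)[OF G(1)] G(2) by simp
  ultimately show "finite ((\<lambda>x. G ((T ^^ k) x)) ` space (future \<Xi> n))"
    by (rule finite_subset)
  fix y assume "y \<in> (\<lambda>x. G ((T ^^ k) x)) ` space (future \<Xi> n)"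
  then have y: "y \<in> G ` space M" using sub by auto
  let ?A = "G -` {y} \<inter> space M"
  have A: "?A \<in> \<Xi>" by (rule lev[OF y])
  have "pullback k ?A \<in> sets (future \<Xi> n)"
    using k
  proof
    assume "n \<le> k"
    then show ?thesis
      using A by (intro future_generator[OF \<Xi>]) (auto simp: block_def)
  next
    assume P: "sets N \<subseteq> sets (pinsker_algebra M T)"
    have "?A \<in> sets N" using simple_functionD(2)[OF G(1), of "{y}"] G(2) by simp
    then have "?A \<in> events" "entropy_rate {?A} = 0"
      using P by (auto simp: sets_pinsker_algebra)
    then have "pullback k ?A \<in> sets (future {?A} n)"
      by (rule zero_entropy_in_future)
    also have "\<dots> \<subseteq> sets (future \<Xi> n)"
      using A by (intro sets_future_mono \<Xi>) auto
    finally show ?thesis .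
  qed
  moreover have "(\<lambda>x. G ((T ^^ k) x)) -` {y} \<inter> space (future \<Xi> n) = pullback k ?A"
    using T_pow_space by (auto simp: pullback_def space_future[OF \<Xi>])
  ultimately show "(\<lambda>x. G ((T ^^ k) x)) -` {y} \<inter> space (future \<Xi> n) \<in> sets (future \<Xi> n)"
    by simp
qed

text \<open>
  Here \<open>b\<close> and \<open>c\<close> are the times at two indices, and \<open>b j\<close> is the earliest time apart from those of the
  Pinsker factors. All factors except the one of \<open>g j\<close> at time \<open>b j\<close> are replaced by simple functions; the
  resulting product is measurable with respect to the future of their level sets after time
  \<open>b j + L\<close>, so that decorrelation from the future applies.
\<close>

lemma correlation_small:
  fixes g :: "nat \<Rightarrow> 'a \<Rightarrow> complex"
  assumes j: "j \<in> {1..l}" and meas: "\<And>i. i \<in> {1..l} \<Longrightarrow> g i \<in> borel_measurable M"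
    and P: "\<And>i. i \<in> {1..<j} \<Longrightarrow> g i \<in> borel_measurable (pinsker_algebra M T)"
    and bd: "\<And>i. i \<in> {1..l} \<Longrightarrow> AE x in M. cmod (g i x) \<le> B" and B: "B \<ge> 1"
    and orth: "AE x in M. complex_cond_exp M (pinsker_algebra M T) (g j) x = 0"
    and \<epsilon>: "\<epsilon> > 0"
  shows "\<exists>L. \<forall>b c. b j + L \<le> c j \<longrightarrow> (\<forall>i\<in>{j<..l}. b j + L \<le> b i \<and> b j + L \<le> c i) \<longrightarrow>
    cmod (\<integral>x. (\<Prod>i=1..l. g i ((T ^^ b i) x)) * cnj (\<Prod>i=1..l. g i ((T ^^ c i) x)) \<partial>M) \<le> \<epsilon>"
proof -
  define N where "N = (\<lambda>i. if i < j then pinsker_algebra M T else M)"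
  have N_sub: "subalgebra M (N i)" for i
    unfolding N_def using subalgebra_pinsker by (auto simp: subalgebra_def)
  have g_N: "g i \<in> borel_measurable (N i)" if "i \<in> {1..l}" for i
    using that meas P by (auto simp: N_def)
  have gL: "g i \<in> Linf M" if "i \<in> {1..l}" for i
    using meas[OF that] bd[OF that] by (rule LinfI)
  \<comment> \<open>The factors are indexed by \<open>(i, e)\<close>, where \<open>e\<close> tells whether the time is \<open>c i\<close>, with complex
    conjugation, or \<open>b i\<close>; \<open>K\<close> omits the factor that has to be isolated.\<close>
  define K where "K = ({1..l} \<times> (UNIV :: bool set)) - {(j, False)}"
  have K: "finite K" "\<And>k. k \<in> K \<Longrightarrow> fst k \<in> {1..l}" by (auto simp: K_def)
  \<comment> \<open>The simple approximations are bounded by twice the bound of the functions.\<close>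
  define D where "D = 2 * B"
  define D' where "D' = D ^ card K"
  have "D \<ge> 1" using B by (simp add: D_def)
  then have D: "D \<ge> 1" "D' \<ge> 1" by (simp_all add: D'_def one_le_power)
  \<comment> \<open>Replacing the \<open>card K\<close> factors changes the integral by at most \<open>B * D' * card K * \<delta>\<close>; the
    summand \<open>1\<close> avoids division by \<open>0\<close>.\<close>
  define \<delta> where "\<delta> = \<epsilon> / (2 * (B * D' * (real (card K) + 1)))"
  have "\<delta> > 0" using \<epsilon> B D by (auto simp: \<delta>_def intro!: divide_pos_pos mult_pos_pos)
  have "\<exists>G. simple_function (N i) G \<and> (\<forall>x\<in>space M. cmod (G x) \<le> D) \<and> (\<integral>x. cmod (g i x - G x) \<partial>M) < \<delta>"
    if i: "i \<in> {1..l}" for i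
  proof -
    obtain G where "simple_function (N i) G" "\<And>x. x \<in> space M \<Longrightarrow> cmod (G x) \<le> 2 * B"
        "(\<integral>x. cmod (g i x - G x) \<partial>M) < \<delta>"
      by (rule bounded_simple_approx[OF N_sub g_N[OF i] bd[OF i] _ \<open>\<delta> > 0\<close>]) (use B in auto)
    then show ?thesis unfolding D_def by blast
  qed
  then obtain G where G: "\<And>i. i \<in> {1..l} \<Longrightarrow> simple_function (N i) (G i)"
      "\<And>i x. i \<in> {1..l} \<Longrightarrow> x \<in> space M \<Longrightarrow> cmod (G i x) \<le> D"
      "\<And>i. i \<in> {1..l} \<Longrightarrow> (\<integral>x. cmod (g i x - G i x) \<partial>M) < \<delta>"
    by metis
  have G_M: "G i \<in> borel_measurable M" if "i \<in> {1..l}" for i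
    by (rule measurable_from_subalg[OF N_sub borel_measurable_simple_function[OF G(1)[OF that]]])
  have GL: "G i \<in> Linf M" if "i \<in> {1..l}" for i
    using G_M[OF that] G(2)[OF that] by (auto intro!: LinfI[of _ _ D])
  have spN: "space (N i) = space M" for i using N_sub by (simp add: subalgebra_def)
  define \<Xi> where "\<Xi> = (\<Union>i\<in>{1..l}. (\<lambda>y. G i -` {y} \<inter> space M) ` (G i ` space M))"
  have fin: "finite \<Xi>"
    unfolding \<Xi>_def using simple_functionD(1)[OF G(1)] by (auto simp: spN)
  have ev: "\<Xi> \<subseteq> events"
    unfolding \<Xi>_def using measurable_sets[OF G_M] by auto
  obtain L where L: "\<forall>s. \<forall>F\<in>borel_measurable (future \<Xi> (s + L)).
      (\<forall>x\<in>space M. cmod (F x) \<le> D') \<longrightarrow> cmod (\<integral>x. g j ((T ^^ s) x) * F x \<partial>M) \<le> \<epsilon> / 2"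
    using future_decorrelation[OF ev fin meas[OF j] bd[OF j] orth half_gt_zero[OF \<epsilon>]] by blast
  show ?thesis
  proof (intro exI[of _ L] allI impI)
    fix b c :: "nat \<Rightarrow> nat"
    assume cj: "b j + L \<le> c j" and bc: "\<forall>i\<in>{j<..l}. b j + L \<le> b i \<and> b j + L \<le> c i"
    define t where "t = (\<lambda>k. if snd k then c (fst k) else b (fst k))"
    define conj where "conj = (\<lambda>(k :: nat \<times> bool) (z :: complex). if snd k then cnj z else z)"
    define z where "z = (\<lambda>k x. conj k (g (fst k) ((T ^^ t k) x)))"
    define w where "w = (\<lambda>k x. conj k (G (fst k) ((T ^^ t k) x)))"
    have norm_conj [simp]: "cmod (conj k y) = cmod y" for k y by (simp add: conj_def)
    have conj_meas: "(\<lambda>x. conj k (h x)) \<in> borel_measurable M'" if "h \<in> borel_measurable M'"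
      for k and h :: "'a \<Rightarrow> complex" and M'
    proof -
      have "cnj \<in> borel_measurable borel"
        by (intro borel_measurable_continuous_onI continuous_intros)
      from measurable_compose[OF that this] that show ?thesis by (simp add: conj_def)
    qed
    have conjL: "(\<lambda>x. conj k (h x)) \<in> Linf M" if "h \<in> Linf M" for k h
      using conj_meas[of h M k] that by (simp add: Linf_def)
    have zL: "z k \<in> Linf M" if "fst k \<in> {1..l}" for k
      unfolding z_def by (intro conjL Linf_T_pow gL that)
    have wL: "w k \<in> Linf M" if "fst k \<in> {1..l}" for k
      unfolding w_def by (intro conjL Linf_T_pow GL that)
    have w_fut: "w k \<in> borel_measurable (future \<Xi> (b j + L))" if "k \<in> K" for k
    proof -
      have i: "fst k \<in> {1..l}" using K(2) that .
      have "b j + L \<le> t k \<or> fst k < j"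
      proof (cases "fst k = j")
        case True
        then have "snd k" using that by (cases k) (auto simp: K_def)
        with True cj show ?thesis by (simp add: t_def)
      next
        case False
        then show ?thesis using i bspec[OF bc, of "fst k"] by (auto simp: t_def)
      qed
      then have "b j + L \<le> t k \<or> sets (N (fst k)) \<subseteq> sets (pinsker_algebra M T)"
        by (auto simp: N_def)
      then have "(\<lambda>x. G (fst k) ((T ^^ t k) x)) \<in> borel_measurable (future \<Xi> (b j + L))"
      proof (rule simple_function_T_pow_future[OF ev G(1)[OF i] spN, rotated])
        fix y assume "y \<in> G (fst k) ` space M"
        then show "G (fst k) -` {y} \<inter> space M \<in> \<Xi>"
          unfolding \<Xi>_def by (intro UN_I[OF i] imageI)
      qed
      then show ?thesis unfolding w_def by (rule conj_meas)
    qed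
    define R F where "R = (\<lambda>x. \<Prod>k\<in>K. z k x)" and "F = (\<lambda>x. \<Prod>k\<in>K. w k x)"
    let ?u = "\<lambda>x. g j ((T ^^ b j) x)"
    have uL: "?u \<in> Linf M" by (intro Linf_T_pow gL j)
    have RL: "R \<in> Linf M" and FL: "F \<in> Linf M"
      unfolding R_def F_def by (intro Linf_prod zL wL K(2); assumption)+
    have "(\<Prod>i=1..l. g i ((T ^^ b i) x)) * cnj (\<Prod>i=1..l. g i ((T ^^ c i) x)) = ?u x * R x" for x
    proof -
      have "(\<Prod>i=1..l. g i ((T ^^ b i) x)) * cnj (\<Prod>i=1..l. g i ((T ^^ c i) x))
          = (\<Prod>i=1..l. \<Prod>e\<in>UNIV. z (i, e) x)"
        by (simp add: UNIV_bool z_def conj_def t_def prod.distrib cnj_prod mult.commute)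
      also have "\<dots> = (\<Prod>k\<in>{1..l} \<times> UNIV. z k x)"
        by (simp add: prod.cartesian_product)
      also have "\<dots> = z (j, False) x * R x"
        unfolding R_def K_def using j by (intro prod.remove) auto
      finally show ?thesis by (simp add: z_def conj_def t_def)
    qed
    then have "(\<integral>x. (\<Prod>i=1..l. g i ((T ^^ b i) x)) * cnj (\<Prod>i=1..l. g i ((T ^^ c i) x)) \<partial>M)
        = (\<integral>x. ?u x * F x + ?u x * (R x - F x) \<partial>M)"
      by (simp add: algebra_simps)
    also have "\<dots> = (\<integral>x. ?u x * F x \<partial>M) + (\<integral>x. ?u x * (R x - F x) \<partial>M)"
      using uL RL FL by (intro Bochner_Integration.integral_add Linf_integrable Linf_mult Linf_diff)
    finally have eq: "(\<integral>x. (\<Prod>i=1..l. g i ((T ^^ b i) x)) * cnj (\<Prod>i=1..l. g i ((T ^^ c i) x)) \<partial>M)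
        = (\<integral>x. ?u x * F x \<partial>M) + (\<integral>x. ?u x * (R x - F x) \<partial>M)" .
    have main: "cmod (\<integral>x. ?u x * F x \<partial>M) \<le> \<epsilon> / 2"
    proof (rule L[rule_format])
      show "F \<in> borel_measurable (future \<Xi> (b j + L))"
        unfolding F_def by (intro borel_measurable_prod w_fut)
      fix x assume "x \<in> space M"
      then have "(\<Prod>k\<in>K. cmod (w k x)) \<le> (\<Prod>k\<in>K. D)"
        using K(2) G(2) T_pow_space by (intro prod_mono) (auto simp: w_def)
      then show "cmod (F x) \<le> D'" by (simp add: F_def D'_def prod_norm)
    qed
    have err_int: "integrable M (\<lambda>x. cmod (z k x - w k x))" if "k \<in> K" for k
      using that K(2) by (intro integrable_norm Linf_integrable Linf_diff zL wL)
    have err: "(\<integral>x. cmod (z k x - w k x) \<partial>M) \<le> \<delta>" if "k \<in> K" for k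
    proof -
      have i: "fst k \<in> {1..l}" using K(2) that .
      have "cmod (z k x - w k x) = cmod (g (fst k) ((T ^^ t k) x) - G (fst k) ((T ^^ t k) x))" for x
      proof -
        have "z k x - w k x = conj k (g (fst k) ((T ^^ t k) x) - G (fst k) ((T ^^ t k) x))"
          by (simp add: z_def w_def conj_def)
        then show ?thesis by simp
      qed
      then have "(\<integral>x. cmod (z k x - w k x) \<partial>M) = (\<integral>x. cmod (g (fst k) x - G (fst k) x) \<partial>M)"
        using meas[OF i] G_M[OF i]
        by (simp add: integral_T_pow[where g = "\<lambda>x. cmod (g (fst k) x - G (fst k) x)"])
      then show ?thesis using G(3)[OF i] by simp
    qed
    have z_bd: "AE x in M. \<forall>k\<in>K. cmod (z k x) \<le> D"
    proof (rule AE_finite_allI[OF K(1)])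
      fix k assume "k \<in> K"
      then have "AE x in M. cmod (g (fst k) ((T ^^ t k) x)) \<le> B"
        using AE_T_pow[OF bd[OF K(2)]] by blast
      then show "AE x in M. cmod (z k x) \<le> D"
        by eventually_elim (use B in \<open>simp add: z_def D_def\<close>)
    qed
    have "AE x in M. cmod (?u x * (R x - F x)) \<le> B * (D' * (\<Sum>k\<in>K. cmod (z k x - w k x)))"
      using z_bd AE_T_pow[OF bd[OF j], of "b j"]
    proof (rule AE_mp[OF AE_conjI], intro AE_I2 impI)
      fix x assume x: "x \<in> space M" "(\<forall>k\<in>K. cmod (z k x) \<le> D) \<and> cmod (?u x) \<le> B"
      have "cmod (R x - F x) \<le> D ^ card K * (\<Sum>k\<in>K. cmod (z k x - w k x))"
        unfolding R_def F_def
        using x K(2) G(2) T_pow_space D(1) by (intro norm_prod_diff_le) (auto simp: w_def)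
      then show "cmod (?u x * (R x - F x)) \<le> B * (D' * (\<Sum>k\<in>K. cmod (z k x - w k x)))"
        unfolding norm_mult D'_def using x B by (intro mult_mono) auto
    qed
    then have "cmod (\<integral>x. ?u x * (R x - F x) \<partial>M) \<le> (\<integral>x. B * (D' * (\<Sum>k\<in>K. cmod (z k x - w k x))) \<partial>M)"
    proof (rule order_trans[OF integral_norm_bound integral_mono_AE, rotated 2])
      show "integrable M (\<lambda>x. cmod (?u x * (R x - F x)))"
        by (intro integrable_norm Linf_integrable Linf_mult Linf_diff uL RL FL)
      show "integrable M (\<lambda>x. B * (D' * (\<Sum>k\<in>K. cmod (z k x - w k x))))"
        by (intro integrable_mult_right Bochner_Integration.integrable_sum err_int)
    qed
    also have "\<dots> = B * (D' * (\<Sum>k\<in>K. \<integral>x. cmod (z k x - w k x) \<partial>M))"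
      using err_int by (simp add: Bochner_Integration.integral_sum)
    also have "\<dots> \<le> B * (D' * (\<Sum>k\<in>K. \<delta>))"
      using B D err by (intro mult_left_mono sum_mono) auto
    also have "\<dots> \<le> B * D' * (real (card K) + 1) * \<delta>"
      using B D \<open>\<delta> > 0\<close> by (simp add: algebra_simps)
    also have "\<dots> = \<epsilon> / 2"
      using B D by (simp add: \<delta>_def)
    finally have "cmod (\<integral>x. ?u x * (R x - F x) \<partial>M) \<le> \<epsilon> / 2" .
    with main show "cmod (\<integral>x. (\<Prod>i=1..l. g i ((T ^^ b i) x)) * cnj (\<Prod>i=1..l. g i ((T ^^ c i) x)) \<partial>M) \<le> \<epsilon>"
      unfolding eq by (intro order_trans[OF norm_triangle_ineq]) simp
  qed
qed

end

section \<open>Telescoping the products\<close>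

lemma prod_diff_telescope:
  fixes x y :: "nat \<Rightarrow> 'b :: comm_ring_1"
  shows "(\<Prod>i=1..l. x i) - (\<Prod>i=1..l. y i) =
    (\<Sum>j=1..l. \<Prod>i=1..l. if i < j then y i else if i = j then x i - y i else x i)"
proof (induction l)
  case (Suc l)
  let ?d = "\<lambda>j i. if i < j then y i else if i = j then x i - y i else x i"
  have "(\<Prod>i=1..Suc l. ?d j i) = (\<Prod>i=1..l. ?d j i) * x (Suc l)" if "j \<in> {1..l}" for j
    using that by simp
  moreover have "(\<Prod>i=1..Suc l. ?d (Suc l) i) = (\<Prod>i=1..l. y i) * (x (Suc l) - y (Suc l))"
    by simp
  ultimately have "(\<Sum>j=1..Suc l. \<Prod>i=1..Suc l. ?d j i) =
      (\<Sum>j=1..l. \<Prod>i=1..l. ?d j i) * x (Suc l) + (\<Prod>i=1..l. y i) * (x (Suc l) - y (Suc l))"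
    by (simp add: sum_distrib_right)
  then show ?case
    unfolding Suc.IH[symmetric] by (simp add: algebra_simps)
qed simp

lemma gaps_tendsto_at_top:
  fixes a :: "nat \<Rightarrow> nat \<Rightarrow> nat"
  assumes gap: "\<And>i. i \<in> {1..<l} \<Longrightarrow> filterlim (\<lambda>n. real (a (i + 1) n) - real (a i n)) at_top sequentially"
    and "1 \<le> j" "j < i" "i \<le> l"
  shows "filterlim (\<lambda>n. real (a i n) - real (a j n)) at_top sequentially"
proof -
  from \<open>j < i\<close> have "Suc j \<le> i" by simp
  then show ?thesis using \<open>i \<le> l\<close>
  proof (induction i rule: dec_induct)
    case base
    then show ?case using gap[of j] \<open>1 \<le> j\<close> by simp
  next
    case (step i)
    have "filterlim (\<lambda>n. (real (a i n) - real (a j n)) + (real (a (i + 1) n) - real (a i n))) at_top sequentially"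
      using step gap[of i] \<open>1 \<le> j\<close> by (intro filterlim_at_top_add_at_top) auto
    then show ?case by (simp add: algebra_simps)
  qed
qed

theorem theorem1p1:
  fixes l :: nat and a :: "nat \<Rightarrow> nat \<Rightarrow> nat"
    and M :: "'a measure" and T :: "'a \<Rightarrow> 'a" and f :: "nat \<Rightarrow> 'a \<Rightarrow> complex"
  assumes "l \<ge> 1"
    and "\<And>i n. i \<in> {1..l} \<Longrightarrow> n \<ge> 1 \<Longrightarrow> a i n \<ge> 1"
    and "\<And>i L::real. i \<in> {1..l} \<Longrightarrow> L > 0 \<Longrightarrow>
           (\<lambda>N. real (card {(m, n). m \<in> {1..N} \<and> n \<in> {1..N} \<and>
                              \<bar>real (a i m) - real (a i n)\<bar> \<le> L}) / (real N)\<^sup>2)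
             \<longlonglongrightarrow> 0"
    and "\<And>i. i \<in> {1..<l} \<Longrightarrow>
           filterlim (\<lambda>n. real (a (i + 1) n) - real (a i n)) at_top sequentially"
    and "measure_preserving_system M T"
    and "\<And>i. i \<in> {1..l} \<Longrightarrow> f i \<in> Linf M"
  shows "tendsto_L2 M
           (\<lambda>N x. (1 / of_nat N) *
              (\<Sum>n=1..N. (\<Prod>i=1..l. f i ((T ^^ a i n) x))
                       - (\<Prod>i=1..l. complex_cond_exp M (pinsker_algebra M T) (f i) ((T ^^ a i n) x))))
           (\<lambda>x. 0)"
proof -
  interpret measure_preserving_system M T by fact
  note spread = assms(3) and gap = assms(4) and fL = assms(6)
  let ?P = "pinsker_algebra M T"
  define p where "p = (\<lambda>i. complex_cond_exp M ?P (f i))"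
  define g where "g = (\<lambda>j i x. if i < j then p i x else if i = j then f i x - p i x else f i x)"
  define avg where "avg = (\<lambda>j N x. (1 / of_nat N) * (\<Sum>n=1..N. \<Prod>i=1..l. g j i ((T ^^ a i n) x)))"
  have "\<exists>C\<ge>0. AE x in M. cmod (f i x) \<le> C" if "i \<in> {1..l}" for i
    using fL[OF that] by (rule Linf_nonneg_bound)
  then obtain C where C: "\<And>i. i \<in> {1..l} \<Longrightarrow> C i \<ge> 0" "\<And>i. i \<in> {1..l} \<Longrightarrow> AE x in M. cmod (f i x) \<le> C i"
    by metis
  \<comment> \<open>A conditional expectation of a complex function bounded by \<open>C i\<close> is bounded by \<open>2 * C i\<close>, taking
    real and imaginary parts separately, and the difference from the function by \<open>3 * C i\<close>.\<close>
  define B where "B = 1 + 3 * (\<Sum>i=1..l. C i)"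
  have B: "B \<ge> 1" using C(1) by (auto simp: B_def intro!: sum_nonneg)
  have CB: "1 + 3 * C i \<le> B" if "i \<in> {1..l}" for i
    using that C(1) member_le_sum[of i "{1..l}" C] by (auto simp: B_def)
  have f_M: "f i \<in> borel_measurable M" if "i \<in> {1..l}" for i
    using fL[OF that] by (rule Linf_measurable)
  have p_P: "p i \<in> borel_measurable ?P" for i
    unfolding p_def by (rule borel_measurable_complex_cond_exp)
  have p_M: "p i \<in> borel_measurable M" for i
    by (rule measurable_from_subalg[OF subalgebra_pinsker p_P])
  have p_bd: "AE x in M. cmod (p i x) \<le> 2 * C i" if "i \<in> {1..l}" for i
    unfolding p_def by (rule complex_cond_exp_bounded[OF subalgebra_pinsker f_M[OF that] C(2)[OF that]])
  have g_M: "g j i \<in> borel_measurable M" if "i \<in> {1..l}" for i j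
    unfolding g_def using p_M f_M[OF that] by simp
  have g_bd: "AE x in M. cmod (g j i x) \<le> B" if "i \<in> {1..l}" for i j
    using p_bd[OF that] C(2)[OF that]
  proof eventually_elim
    case (elim x)
    then show ?case
      using CB[OF that] C(1)[OF that] norm_triangle_ineq4[of "f i x" "p i x"] by (auto simp: g_def)
  qed
  have gL: "g j i \<in> Linf M" if "i \<in> {1..l}" for i j
    using g_M[OF that] g_bd[OF that] by (rule LinfI)
  have prodL: "(\<lambda>x. \<Prod>i=1..l. g j i ((T ^^ a i n) x)) \<in> Linf M" for j n
    by (intro Linf_prod Linf_T_pow gL)
  have avgL: "avg j N \<in> Linf M" for j N
    unfolding avg_def by (intro Linf_mult Linf_const Linf_sum prodL)
  have avg_0: "(\<lambda>N. \<integral>x. (cmod (avg j N x))\<^sup>2 \<partial>M) \<longlonglongrightarrow> 0" if j: "j \<in> {1..l}" for j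
    unfolding avg_def
  proof (rule average_tendsto_0[where C = "B ^ l" and a = "a j"])
    show "(\<lambda>x. \<Prod>i=1..l. g j i ((T ^^ a i n) x)) \<in> borel_measurable M" for n
      using prodL by (rule Linf_measurable)
    show "AE x in M. cmod (\<Prod>i=1..l. g j i ((T ^^ a i n) x)) \<le> B ^ l" for n
    proof -
      have "AE x in M. \<forall>i\<in>{1..l}. cmod (g j i ((T ^^ a i n) x)) \<le> B"
        by (intro AE_finite_allI AE_T_pow[OF g_bd]) auto
      then show ?thesis
      proof eventually_elim
        case (elim x)
        then have "(\<Prod>i=1..l. cmod (g j i ((T ^^ a i n) x))) \<le> (\<Prod>i=1..l. B)"
          by (intro prod_mono) auto
        then show ?case by (simp add: prod_norm)
      qed
    qed
    show "B ^ l \<ge> 0" using B by simp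
    show "(\<lambda>N. real (card {(m, n). m \<in> {1..N} \<and> n \<in> {1..N} \<and> \<bar>real (a j m) - real (a j n)\<bar> \<le> L}) / (real N)\<^sup>2)
          \<longlonglongrightarrow> 0" if "L > 0" for L
      using j that by (rule spread)
    fix \<epsilon> :: real assume \<epsilon>: "\<epsilon> > 0"
    have orth: "AE x in M. complex_cond_exp M ?P (g j j) x = 0"
      using complex_cond_exp_residual[OF subalgebra_pinsker f_M[OF j] C(2)[OF j]]
      by (simp add: g_def p_def)
    have g_P: "g j i \<in> borel_measurable ?P" if "i \<in> {1..<j}" for i
      using that p_P by (simp add: g_def)
    obtain L where L: "\<forall>b c. b j + L \<le> c j \<longrightarrow> (\<forall>i\<in>{j<..l}. b j + L \<le> b i \<and> b j + L \<le> c i) \<longrightarrow>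
        cmod (\<integral>x. (\<Prod>i=1..l. g j i ((T ^^ b i) x)) * cnj (\<Prod>i=1..l. g j i ((T ^^ c i) x)) \<partial>M) \<le> \<epsilon>"
      using correlation_small[of j l "g j" B \<epsilon>, OF j g_M g_P g_bd B orth \<epsilon>] by blast
    have "\<forall>\<^sub>F n in sequentially. \<forall>i\<in>{j<..l}. real L \<le> real (a i n) - real (a j n)"
      using j gaps_tendsto_at_top[of l a j, OF gap]
      by (intro eventually_ball_finite) (auto simp: filterlim_at_top)
    then obtain n0 where n0: "\<forall>n\<ge>n0. \<forall>i\<in>{j<..l}. real L \<le> real (a i n) - real (a j n)"
      unfolding eventually_sequentially by blast
    have n0': "a j n + L \<le> a i n" if "n \<ge> n0" "i \<in> {j<..l}" for n i
      using n0[rule_format, OF that] by linarith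
    show "\<exists>L n0. \<forall>m\<ge>n0. \<forall>n\<ge>n0. a j m + L \<le> a j n \<longrightarrow>
        cmod (\<integral>x. (\<Prod>i=1..l. g j i ((T ^^ a i m) x)) * cnj (\<Prod>i=1..l. g j i ((T ^^ a i n) x)) \<partial>M) \<le> \<epsilon>"
    proof (intro exI allI impI)
      fix m n assume mn: "n0 \<le> m" "n0 \<le> n" "a j m + L \<le> a j n"
      have "a j m + L \<le> a i m \<and> a j m + L \<le> a i n" if "i \<in> {j<..l}" for i
        using n0'[OF mn(1) that] n0'[OF mn(2) that] mn(3) by linarith
      then show "cmod (\<integral>x. (\<Prod>i=1..l. g j i ((T ^^ a i m) x)) * cnj (\<Prod>i=1..l. g j i ((T ^^ a i n) x)) \<partial>M) \<le> \<epsilon>"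
        using mn(3) by (intro L[rule_format, of "\<lambda>i. a i m" "\<lambda>i. a i n"]) auto
    qed
  qed
  let ?F = "\<lambda>N x. (1 / of_nat N) * (\<Sum>n=1..N. (\<Prod>i=1..l. f i ((T ^^ a i n) x)) - (\<Prod>i=1..l. p i ((T ^^ a i n) x)))"
  have F_eq: "?F N x = (\<Sum>j=1..l. avg j N x)" for N x
  proof -
    have "(\<Prod>i=1..l. f i ((T ^^ a i n) x)) - (\<Prod>i=1..l. p i ((T ^^ a i n) x))
        = (\<Sum>j=1..l. \<Prod>i=1..l. g j i ((T ^^ a i n) x))" for n
      unfolding g_def by (rule prod_diff_telescope)
    then have "?F N x = (1 / of_nat N) * (\<Sum>j=1..l. \<Sum>n=1..N. \<Prod>i=1..l. g j i ((T ^^ a i n) x))"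
      by (simp only: sum.swap[of _ "{1..l}" "{1..N}"])
    then show ?thesis unfolding avg_def sum_distrib_left[symmetric] .
  qed
  have FL: "?F N \<in> Linf M" for N
    unfolding F_eq by (intro Linf_sum avgL)
  have F_0: "(\<lambda>N. \<integral>x. (cmod (?F N x))\<^sup>2 \<partial>M) \<longlonglongrightarrow> 0"
  proof (rule tendsto_sandwich[OF always_eventually always_eventually tendsto_const], safe)
    fix N
    show "0 \<le> (\<integral>x. (cmod (?F N x))\<^sup>2 \<partial>M)" by simp
    have "(cmod (?F N x))\<^sup>2 \<le> real l * (\<Sum>j=1..l. (cmod (avg j N x))\<^sup>2)" for x
    proof -
      have "(cmod (?F N x))\<^sup>2 \<le> (\<Sum>j=1..l. cmod (avg j N x))\<^sup>2"
        unfolding F_eq by (intro power_mono norm_sum norm_ge_zero)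
      also have "\<dots> \<le> (\<Sum>j=1..l. (cmod (avg j N x))\<^sup>2) * card {1..l}"
        by (rule sum_squared_le_sum_of_squares)
      finally show ?thesis by (simp add: mult.commute)
    qed
    then have "(\<integral>x. (cmod (?F N x))\<^sup>2 \<partial>M) \<le> (\<integral>x. real l * (\<Sum>j=1..l. (cmod (avg j N x))\<^sup>2) \<partial>M)"
      using FL avgL
      by (intro integral_mono Linf_norm_integrable integrable_mult_right Bochner_Integration.integrable_sum)
    also have "\<dots> = real l * (\<Sum>j=1..l. \<integral>x. (cmod (avg j N x))\<^sup>2 \<partial>M)"
      using avgL by (simp add: Bochner_Integration.integral_sum Linf_norm_integrable)
    finally show "(\<integral>x. (cmod (?F N x))\<^sup>2 \<partial>M) \<le> real l * (\<Sum>j=1..l. \<integral>x. (cmod (avg j N x))\<^sup>2 \<partial>M)" .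
  next
    have "(\<lambda>N. real l * (\<Sum>j=1..l. \<integral>x. (cmod (avg j N x))\<^sup>2 \<partial>M)) \<longlonglongrightarrow> real l * (\<Sum>j=1..l. 0)"
      by (intro tendsto_intros avg_0)
    then show "(\<lambda>N. real l * (\<Sum>j=1..l. \<integral>x. (cmod (avg j N x))\<^sup>2 \<partial>M)) \<longlonglongrightarrow> 0" by simp
  qed
  have "(\<lambda>N. L2_norm M (\<lambda>x. ?F N x - 0)) \<longlonglongrightarrow> 0"
    using tendsto_real_sqrt[OF F_0] by (simp add: L2_norm_def)
  moreover have "?F N \<in> L2 M" for N
    using FL[of N] by (simp add: L2_def Linf_measurable Linf_norm_integrable)
  moreover have "(\<lambda>x. 0) \<in> L2 M" by (simp add: L2_def)
  ultimately show ?thesis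
    unfolding tendsto_L2_def p_def by blast
qed

end
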